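(* Let $G$ be a finite group and let $\mathcal{O}$ be a $G$-transfer system. For each equivalence class $[H]^{\mathcal{O}}$ of inseparable subgroups (represented by $H$ with $H\to G$ in $\mathcal{O}$), we have $$\iota^{\mathcal{O}}(e_{[H]^{\mathcal{O}}})=\sum_{(K)\in[H]^{\mathcal{O}}/G}e_{(K)}$$ in the rational Burnside ring $\underline{A}_{\mathbb{Q}}(G/G)$ of $G$, where the sum is over the $G$-conjugacy classes $(K)$ of subgroups in $[H]^{\mathcal{O}}$ and $e_{(K)}$ denotes the idempotent of the classical rational Burnside ring corresponding to the conjugacy class of the subgroup $K$.
   Context: A $G$-transfer system $\mathcal{O}$ is a partial order on the set $\mathrm{Sub}(G)$ of subgroups of $G$, written $K\to H$, which refines inclusion and satisfies: $K\to H$ implies $gKg^{-1}\to gHg^{-1}$ for all $g\in G$; and $K\to H$, $L\subseteq H$ imply $K\cap L\to L$. $\mathrm{Sub}^{\mathcal{O}}(G)$ is the set of subgroups $H$ with $H\to G$ in $\mathcal{O}$. For every subgroup $J$ there is a unique smallest element $H_{\mathcal{O}}(J)$ of $\mathrm{Sub}^{\mathcal{O}}(G)$ containing $J$. Subgroups $J,K$ are inseparable if $H_{\mathcal{O}}(J)$ and $H_{\mathcal{O}}(K)$ are conjugate in $G$; $[H]^{\mathcal{O}}$ is the inseparability (equivalence) class of $H$; it is closed under conjugation. $\underline{A}^{\mathcal{O}}_{\mathbb{Q}}(G/G)$ is the rationalization of the Grothendieck ring of finite $G$-sets all of whose orbits are isomorphic to some $G/K$ with $K\to G$ in $\mathcal{O}$;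 $\underline{A}_{\mathbb{Q}}(G/G)$ is the usual rational Burnside ring (all finite $G$-sets), and $\iota^{\mathcal{O}}\colon\underline{A}^{\mathcal{O}}_{\mathbb{Q}}(G/G)\to\underline{A}_{\mathbb{Q}}(G/G)$ is the ring map induced by the inclusion of such $G$-sets into all finite $G$-sets. $e_{[H]^{\mathcal{O}}}$ is the idempotent corresponding to the characteristic function of the conjugacy class of $H$ under the ring isomorphism from $\underline{A}^{\mathcal{O}}_{\mathbb{Q}}(G/G)$ to conjugation-invariant functions $\mathrm{Sub}^{\mathcal{O}}(G)\to\mathbb{Q}$ induced by $T\mapsto(K\mapsto|T^K|)$. Similarly $e_{(K)}$ corresponds to the characteristic function of the conjugacy class of $K$ under the isomorphism from $\underline{A}_{\mathbb{Q}}(G/G)$ to conjugation-invariant functions $\mathrm{Sub}(G)\to\mathbb{Q}$ induced by the same formula. *)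

theory Defs
  imports Complex_Main "HOL-Algebra.Group_Action" "HOL-Algebra.Left_Coset" "HOL-Algebra.Ring"
begin

section \<open>Transfer systems and inseparable subgroups\<close>

definition subgroups :: "('g, 'm) monoid_scheme \<Rightarrow> 'g set set" where
  "subgroups G = {H. subgroup H G}"

definition conj_class :: "('g, 'm) monoid_scheme \<Rightarrow> 'g set \<Rightarrow> 'g set set" where
  "conj_class G H = (\<lambda>g. g <#\<^bsub>G\<^esub> H #>\<^bsub>G\<^esub> inv\<^bsub>G\<^esub> g) ` carrier G"

text \<open>An arrow \<open>K \<rightarrow> H\<close> is encoded as \<open>(K, H) \<in> \<O>\<close>.\<close>

locale transfer_system = group G for G (structure) +
  fixes \<O> :: "('a set \<times> 'a set) set"
  assumes partial_order: "partial_order_on (subgroups G) \<O>"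
    and refines_inclusion: "(K, H) \<in> \<O> \<Longrightarrow> K \<subseteq> H"
    and conj_closed: "(K, H) \<in> \<O> \<Longrightarrow> g \<in> carrier G \<Longrightarrow> (g <# K #> inv g, g <# H #> inv g) \<in> \<O>"
    and restriction_closed: "(K, H) \<in> \<O> \<Longrightarrow> subgroup L G \<Longrightarrow> L \<subseteq> H \<Longrightarrow> (K \<inter> L, L) \<in> \<O>"

definition admissible_subgroups ::
  "('g, 'm) monoid_scheme \<Rightarrow> ('g set \<times> 'g set) set \<Rightarrow> 'g set set" where
  "admissible_subgroups G \<O> = {H \<in> subgroups G. (H, carrier G) \<in> \<O>}"

definition admissible_hull ::
  "('g, 'm) monoid_scheme \<Rightarrow> ('g set \<times> 'g set) set \<Rightarrow> 'g set \<Rightarrow> 'g set" where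
  "admissible_hull G \<O> J = (LEAST H. H \<in> admissible_subgroups G \<O> \<and> J \<subseteq> H)"

definition inseparable ::
  "('g, 'm) monoid_scheme \<Rightarrow> ('g set \<times> 'g set) set \<Rightarrow> 'g set \<Rightarrow> 'g set \<Rightarrow> bool" where
  "inseparable G \<O> J K \<longleftrightarrow> admissible_hull G \<O> K \<in> conj_class G (admissible_hull G \<O> J)"

definition insep_class ::
  "('g, 'm) monoid_scheme \<Rightarrow> ('g set \<times> 'g set) set \<Rightarrow> 'g set \<Rightarrow> 'g set set" where
  "insep_class G \<O> H = {K \<in> subgroups G. inseparable G \<O> H K}"


section \<open>Finite \<open>G\<close>-sets\<close>

type_synonym ('g, 'x) gset = "'x set \<times> ('g \<Rightarrow> 'x \<Rightarrow> 'x)"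

definition is_finite_gset :: "('g, 'm) monoid_scheme \<Rightarrow> ('g, 'x) gset \<Rightarrow> bool" where
  "is_finite_gset G = (\<lambda>(X, \<phi>). finite X \<and> group_action G X \<phi>)"

definition gset_iso ::
  "('g, 'm) monoid_scheme \<Rightarrow> ('g, 'x) gset \<Rightarrow> ('g, 'y) gset \<Rightarrow> bool" where
  "gset_iso G = (\<lambda>(X, \<phi>) (Y, \<psi>).
     \<exists>f. bij_betw f X Y \<and> (\<forall>g \<in> carrier G. \<forall>x \<in> X. f (\<phi> g x) = \<psi> g (f x)))"

text \<open>
  The actions below are restricted to the underlying set because \<^const>\<open>group_action\<close>
  requires the action maps to be extensional.
\<close>

definition gset_empty :: "('g, 'x) gset" where
  "gset_empty = ({}, \<lambda>g. restrict id {})"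

definition gset_point :: "('g, unit) gset" where
  "gset_point = (UNIV, \<lambda>g. id)"

definition gset_sum :: "('g, 'x) gset \<Rightarrow> ('g, 'y) gset \<Rightarrow> ('g, 'x + 'y) gset" where
  "gset_sum = (\<lambda>(X, \<phi>) (Y, \<psi>). (X <+> Y, \<lambda>g. restrict (map_sum (\<phi> g) (\<psi> g)) (X <+> Y)))"

definition gset_prod :: "('g, 'x) gset \<Rightarrow> ('g, 'y) gset \<Rightarrow> ('g, 'x \<times> 'y) gset" where
  "gset_prod = (\<lambda>(X, \<phi>) (Y, \<psi>). (X \<times> Y, \<lambda>g. restrict (map_prod (\<phi> g) (\<psi> g)) (X \<times> Y)))"

definition coset_gset :: "('g, 'm) monoid_scheme \<Rightarrow> 'g set \<Rightarrow> ('g, 'g set) gset" where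
  "coset_gset G K = (lcosets\<^bsub>G\<^esub> K, \<lambda>g. \<lambda>C \<in> lcosets\<^bsub>G\<^esub> K. g <#\<^bsub>G\<^esub> C)"

text \<open>
  Every finite \<open>G\<close>-set is isomorphic to one whose underlying set is a set of natural numbers, so
  the isomorphism class of a \<open>G\<close>-set over any type is represented by its members over
  \<^typ>\<open>nat\<close>.
\<close>

definition finite_gsets :: "('g, 'm) monoid_scheme \<Rightarrow> ('g, nat) gset set" where
  "finite_gsets G = {T. is_finite_gset G T}"

definition admissible_gsets ::
  "('g, 'm) monoid_scheme \<Rightarrow> ('g set \<times> 'g set) set \<Rightarrow> ('g, nat) gset set" where
  "admissible_gsets G \<O> = {(X, \<phi>) \<in> finite_gsets G. \<forall>U \<in> orbits G X \<phi>.
     \<exists>K \<in> admissible_subgroups G \<O>. gset_iso G (U, \<lambda>g. restrict (\<phi> g) U) (coset_gset G K)}"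

definition iso_class :: "('g, 'm) monoid_scheme \<Rightarrow> ('g, 'x) gset \<Rightarrow> ('g, nat) gset set" where
  "iso_class G S = {T \<in> finite_gsets G. gset_iso G S T}"

definition fixed_points :: "'g set \<Rightarrow> ('g, 'x) gset \<Rightarrow> 'x set" where
  "fixed_points K = (\<lambda>(X, \<phi>). {x \<in> X. \<forall>k \<in> K. \<phi> k x = x})"

text \<open>
  The semiring of isomorphism classes of the \<open>G\<close>-sets in \<open>\<C>\<close>, a collection closed under
  isomorphism, disjoint union and product. Operations on equivalence classes, here and
  below, use \<^const>\<open>the_elem\<close> to select the value common to all representatives.
\<close>

definition gset_semiring ::
  "('g, 'm) monoid_scheme \<Rightarrow> ('g, nat) gset set \<Rightarrow> ('g, nat) gset set ring" where
  "gset_semiring G \<C> = \<lparr>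
     carrier = iso_class G ` \<C>,
     mult = (\<lambda>a b. the_elem ((\<lambda>(S, T). iso_class G (gset_prod S T)) ` (a \<times> b))),
     one = iso_class G gset_point,
     zero = iso_class G (gset_empty :: ('g, nat) gset),
     add = (\<lambda>a b. the_elem ((\<lambda>(S, T). iso_class G (gset_sum S T)) ` (a \<times> b)))\<rparr>"


section \<open>Grothendieck rings\<close>

text \<open>The class of \<open>(a, b)\<close> is the formal difference \<open>a - b\<close>.\<close>

definition groth_rel :: "('a, 'm) ring_scheme \<Rightarrow> (('a \<times> 'a) \<times> ('a \<times> 'a)) set" where
  "groth_rel S = {((a, b), (c, d)) | a b c d.
     a \<in> carrier S \<and> b \<in> carrier S \<and> c \<in> carrier S \<and> d \<in> carrier S \<and>
     (\<exists>k \<in> carrier S. a \<oplus>\<^bsub>S\<^esub> d \<oplus>\<^bsub>S\<^esub> k = c \<oplus>\<^bsub>S\<^esub> b \<oplus>\<^bsub>S\<^esub> k)}"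

definition groth_class :: "('a, 'm) ring_scheme \<Rightarrow> 'a \<times> 'a \<Rightarrow> ('a \<times> 'a) set" where
  "groth_class S p = groth_rel S `` {p}"

definition groth_ring :: "('a, 'm) ring_scheme \<Rightarrow> ('a \<times> 'a) set ring" where
  "groth_ring S = \<lparr>
     carrier = (carrier S \<times> carrier S) // groth_rel S,
     mult = (\<lambda>x y. the_elem ((\<lambda>((a, b), (c, d)).
        groth_class S (a \<otimes>\<^bsub>S\<^esub> c \<oplus>\<^bsub>S\<^esub> b \<otimes>\<^bsub>S\<^esub> d, a \<otimes>\<^bsub>S\<^esub> d \<oplus>\<^bsub>S\<^esub> b \<otimes>\<^bsub>S\<^esub> c)) ` (x \<times> y))),
     one = groth_class S (\<one>\<^bsub>S\<^esub>, \<zero>\<^bsub>S\<^esub>),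
     zero = groth_class S (\<zero>\<^bsub>S\<^esub>, \<zero>\<^bsub>S\<^esub>),
     add = (\<lambda>x y. the_elem ((\<lambda>((a, b), (c, d)).
        groth_class S (a \<oplus>\<^bsub>S\<^esub> c, b \<oplus>\<^bsub>S\<^esub> d)) ` (x \<times> y)))\<rparr>"

definition groth_map ::
  "('b, 'm) ring_scheme \<Rightarrow> ('a \<Rightarrow> 'b) \<Rightarrow> ('a \<times> 'a) set \<Rightarrow> ('b \<times> 'b) set" where
  "groth_map S' f x = the_elem ((\<lambda>(a, b). groth_class S' (f a, f b)) ` x)"

definition groth_extend :: "('a \<Rightarrow> rat) \<Rightarrow> ('a \<times> 'a) set \<Rightarrow> rat" where
  "groth_extend f x = the_elem ((\<lambda>(a, b). f a - f b) ` x)"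


section \<open>Rationalization\<close>

text \<open>
  The rationalization of \<open>R\<close> is its localization at the nonzero integers. The class of \<open>(a, n)\<close> is
  the fraction \<open>a / n\<close>; the factor \<open>k\<close> in the relation accounts for torsion.
\<close>

definition rat_rel :: "('a, 'm) ring_scheme \<Rightarrow> (('a \<times> int) \<times> ('a \<times> int)) set" where
  "rat_rel R = {((a, n), (b, m)) | a n b m.
     a \<in> carrier R \<and> b \<in> carrier R \<and> n \<noteq> 0 \<and> m \<noteq> 0 \<and>
     (\<exists>k. k \<noteq> 0 \<and> [(k * m)] \<cdot>\<^bsub>R\<^esub> a = [(k * n)] \<cdot>\<^bsub>R\<^esub> b)}"

definition rat_class :: "('a, 'm) ring_scheme \<Rightarrow> 'a \<times> int \<Rightarrow> ('a \<times> int) set" where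
  "rat_class R p = rat_rel R `` {p}"

definition rationalization :: "('a, 'm) ring_scheme \<Rightarrow> ('a \<times> int) set ring" where
  "rationalization R = \<lparr>
     carrier = (carrier R \<times> (UNIV - {0})) // rat_rel R,
     mult = (\<lambda>x y. the_elem ((\<lambda>((a, n), (b, m)).
        rat_class R (a \<otimes>\<^bsub>R\<^esub> b, n * m)) ` (x \<times> y))),
     one = rat_class R (\<one>\<^bsub>R\<^esub>, 1),
     zero = rat_class R (\<zero>\<^bsub>R\<^esub>, 1),
     add = (\<lambda>x y. the_elem ((\<lambda>((a, n), (b, m)).
        rat_class R ([m] \<cdot>\<^bsub>R\<^esub> a \<oplus>\<^bsub>R\<^esub> [n] \<cdot>\<^bsub>R\<^esub> b, n * m)) ` (x \<times> y)))\<rparr>"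

definition rat_map ::
  "('b, 'm) ring_scheme \<Rightarrow> ('a \<Rightarrow> 'b) \<Rightarrow> ('a \<times> int) set \<Rightarrow> ('b \<times> int) set" where
  "rat_map R' f x = the_elem ((\<lambda>(a, n). rat_class R' (f a, n)) ` x)"

definition rat_extend :: "('a \<Rightarrow> rat) \<Rightarrow> ('a \<times> int) set \<Rightarrow> rat" where
  "rat_extend f x = the_elem ((\<lambda>(a, n). f a / of_int n) ` x)"


section \<open>Rational Burnside rings, marks and idempotents\<close>

type_synonym 'g burnside_elt = "((('g, nat) gset set \<times> ('g, nat) gset set) set \<times> int) set"

text \<open>The rationalized Grothendieck ring of the finite \<open>G\<close>-sets in \<open>\<C>\<close>.\<close>

definition rational_gset_ring ::
  "('g, 'm) monoid_scheme \<Rightarrow> ('g, nat) gset set \<Rightarrow> 'g burnside_elt ring" where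
  "rational_gset_ring G \<C> = rationalization (groth_ring (gset_semiring G \<C>))"

abbreviation burnside_ring :: "('g, 'm) monoid_scheme \<Rightarrow> 'g burnside_elt ring" where
  "burnside_ring G \<equiv> rational_gset_ring G (finite_gsets G)"

abbreviation transfer_burnside_ring ::
  "('g, 'm) monoid_scheme \<Rightarrow> ('g set \<times> 'g set) set \<Rightarrow> 'g burnside_elt ring" where
  "transfer_burnside_ring G \<O> \<equiv> rational_gset_ring G (admissible_gsets G \<O>)"

text \<open>
  Isomorphism classes are always formed inside all finite \<open>G\<close>-sets and \<^term>\<open>admissible_gsets G \<O>\<close>
  is closed under isomorphism, so on isomorphism classes the inclusion is the identity.
  It is not the identity on formal differences and fractions, whose equivalence relations
  depend on the ambient semiring.
\<close>

definition burnside_inclusion ::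
  "('g, 'm) monoid_scheme \<Rightarrow> 'g burnside_elt \<Rightarrow> 'g burnside_elt" where
  "burnside_inclusion G =
     rat_map (groth_ring (gset_semiring G (finite_gsets G)))
       (groth_map (gset_semiring G (finite_gsets G)) (\<lambda>a. a))"

text \<open>The additive extension of \<open>T \<mapsto> (K \<mapsto> |T\<^sup>K|)\<close>, with \<open>K\<close> ranging over \<open>\<F>\<close>.\<close>

definition marks :: "'g set set \<Rightarrow> 'g burnside_elt \<Rightarrow> 'g set \<Rightarrow> rat" where
  "marks \<F> x = (\<lambda>K \<in> \<F>. rat_extend (groth_extend
      (\<lambda>a. the_elem ((\<lambda>T. of_nat (card (fixed_points K T))) ` a))) x)"

definition char_fun :: "'g set set \<Rightarrow> 'g set set \<Rightarrow> 'g set \<Rightarrow> rat" where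
  "char_fun \<F> C = (\<lambda>K \<in> \<F>. if K \<in> C then 1 else 0)"

text \<open>
  The elements corresponding to the characteristic function of a conjugacy class \<open>C\<close> under the
  isomorphisms given by the marks; \<open>C\<close> consists of admissible subgroups in the first case.
\<close>

definition transfer_idempotent ::
  "('g, 'm) monoid_scheme \<Rightarrow> ('g set \<times> 'g set) set \<Rightarrow> 'g set set \<Rightarrow> 'g burnside_elt" where
  "transfer_idempotent G \<O> C =
     the_inv_into (carrier (transfer_burnside_ring G \<O>)) (marks (admissible_subgroups G \<O>))
       (char_fun (admissible_subgroups G \<O>) C)"

definition burnside_idempotent ::
  "('g, 'm) monoid_scheme \<Rightarrow> 'g set set \<Rightarrow> 'g burnside_elt" where
  "burnside_idempotent G C =
     the_inv_into (carrier (burnside_ring G)) (marks (subgroups G)) (char_fun (subgroups G) C)"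

end

theory Submission
  imports Defs
begin

text \<open>
  Elements of a rational Burnside ring are determined by their marks \<open>K \<mapsto> |T\<^sup>K|\<close>, so the two sides
  are compared mark by mark. A point of an admissible \<open>G\<close>-set is fixed by \<open>K\<close> iff its stabilizer,
  which is admissible, contains \<open>K\<close>, i.e. contains the hull of \<open>K\<close>. Hence the mark of \<open>\<iota>(x)\<close> at \<open>K\<close> is
  the mark of \<open>x\<close> at the hull of \<open>K\<close>, and for the idempotent of \<open>H\<close> this is \<open>1\<close> exactly if \<open>K\<close> is
  inseparable from \<open>H\<close>, as it is for the sum of the idempotents of the conjugacy classes in the
  inseparability class.

  That marks with index in a conjugation-closed family \<open>F\<close> of subgroups separate and realize all class
  functions on \<open>F\<close> holds for the \<open>G\<close>-sets with isotropy in \<open>F\<close>. Two of them with equal marks have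
  isomorphic orbits at a maximal stabilizer, which can be removed. The marks of \<open>G/H\<close> vanish at \<open>K\<close>
  unless \<open>K\<close> is subconjugate to \<open>H\<close>, so indicator functions of conjugacy classes are obtained by
  induction on \<open>|H|\<close>. The admissible subgroups and all subgroups are both such families.
\<close>

text \<open>Operations on classes are defined by \<open>the_elem\<close> of an image. A member of
  \<open>A\<close> makes the image nonempty and constancy of \<open>f\<close> makes it a singleton,
  so evaluating such an operation amounts to checking independence of representatives.\<close>

lemma the_elem_image_eq:
  assumes "x \<in> A" and "\<And>y. y \<in> A \<Longrightarrow> f y = c"
  shows "the_elem (f ` A) = c"
proof -
  have "f ` A = {c}" using assms by auto
  then show ?thesis by simp
qed

lemma rat_rel_iff:
  "((a, n), (b, m)) \<in> rat_rel R \<longleftrightarrow> a \<in> carrier R \<and> b \<in> carrier R \<and> n \<noteq> 0 \<and> m \<noteq> 0 \<and>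
    (\<exists>k. k \<noteq> 0 \<and> [(k * m)] \<cdot>\<^bsub>R\<^esub> a = [(k * n)] \<cdot>\<^bsub>R\<^esub> b)"
proof -
  \<comment> \<open>An arbitrary \<open>P\<close> keeps the simplifier from rewriting the multiples
    inside the condition.\<close>
  have "((a, n), (b, m)) \<in> {((a, n), (b, m)) | a n b m. P a n b m} \<longleftrightarrow> P a n b m" for P
    by simp
  then show ?thesis unfolding rat_rel_def by (rule trans[OF _ refl])
qed

section \<open>Monoids separated by additive functions\<close>

text \<open>Injectivity of the family \<open>\<nu>\<close> embeds the monoid additively into the
  rational-valued functions on \<open>F\<close>. Identities can then be checked mark by mark, and
  associativity, commutativity and cancellation are inherited from the rationals. The locale is used
  in turn for isomorphism classes, formal differences and fractions.\<close>

locale marked_monoid =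
  fixes R (structure) and \<nu> :: "'k \<Rightarrow> 'a \<Rightarrow> rat" and F :: "'k set"
  assumes add_closed: "\<lbrakk>a \<in> carrier R; b \<in> carrier R\<rbrakk> \<Longrightarrow> a \<oplus> b \<in> carrier R"
    and zero_in: "\<zero> \<in> carrier R"
    and mark_zero: "K \<in> F \<Longrightarrow> \<nu> K \<zero> = 0"
    and mark_add: "\<lbrakk>K \<in> F; a \<in> carrier R; b \<in> carrier R\<rbrakk> \<Longrightarrow> \<nu> K (a \<oplus> b) = \<nu> K a + \<nu> K b"
    and mark_inj: "\<lbrakk>a \<in> carrier R; b \<in> carrier R; \<And>K. K \<in> F \<Longrightarrow> \<nu> K a = \<nu> K b\<rbrakk> \<Longrightarrow> a = b"
begin

sublocale abelian_monoid R
proof (rule abelian_monoidI)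
  fix x y z
  assume "x \<in> carrier R" "y \<in> carrier R" "z \<in> carrier R"
  then show "x \<oplus> y \<oplus> z = x \<oplus> (y \<oplus> z)"
    by (intro mark_inj) (auto simp: add_closed mark_add)
qed (auto intro!: mark_inj simp: add_closed zero_in mark_add mark_zero)

lemma mark_finsum:
  assumes "K \<in> F" and "f \<in> A \<rightarrow> carrier R"
  shows "\<nu> K (finsum R f A) = (\<Sum>i\<in>A. \<nu> K (f i))"
  using assms(2)
\<comment> \<open>For infinite \<open>A\<close> both sums have the default value zero.\<close>
proof (induction A rule: infinite_finite_induct)
  case (insert i A)
  then have "f i \<in> carrier R" "f \<in> A \<rightarrow> carrier R" by auto
  with insert show ?case
    by (simp add: finsum_insert mark_add[OF assms(1)] finsum_closed)
qed (simp_all add: finsum_infinite mark_zero assms(1))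

section \<open>The Grothendieck group of a marked monoid\<close>

lemma groth_class_eq:
  assumes "a \<in> carrier R" "b \<in> carrier R"
  shows "groth_class R (a, b) =
    {(c, d). c \<in> carrier R \<and> d \<in> carrier R \<and> (\<forall>K\<in>F. \<nu> K a - \<nu> K b = \<nu> K c - \<nu> K d)}"
proof -
  \<comment> \<open>The summand \<open>k\<close> cancels in the rationals, and conversely
    \<open>\<zero>\<close> serves as \<open>k\<close> because marks separate elements. Classes of
    pairs are thus the level sets of differences of marks, which reduces well-definedness of all
    operations below to rational arithmetic.\<close>
  have "(\<exists>k \<in> carrier R. a \<oplus> d \<oplus> k = c \<oplus> b \<oplus> k) \<longleftrightarrow>
      (\<forall>K\<in>F. \<nu> K a - \<nu> K b = \<nu> K c - \<nu> K d)" (is "?L \<longleftrightarrow> ?R")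
    if cd: "c \<in> carrier R" "d \<in> carrier R" for c d
  proof
    assume ?L
    then obtain k where k: "k \<in> carrier R" "a \<oplus> d \<oplus> k = c \<oplus> b \<oplus> k" by blast
    show ?R
    proof
      fix K assume K: "K \<in> F"
      from k(2) have "\<nu> K (a \<oplus> d \<oplus> k) = \<nu> K (c \<oplus> b \<oplus> k)" by simp
      then show "\<nu> K a - \<nu> K b = \<nu> K c - \<nu> K d"
        using assms cd k(1) K by (simp add: mark_add add_closed)
    qed
  next
    assume R: ?R
    have "a \<oplus> d \<oplus> \<zero> = c \<oplus> b \<oplus> \<zero>"
      using assms cd R by (intro mark_inj) (auto simp: add_closed zero_in mark_add mark_zero algebra_simps)
    then show ?L using zero_in by blast
  qed
  then show ?thesis
    using assms unfolding groth_class_def groth_rel_def by auto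
qed

lemma groth_class_cong:
  assumes "a \<in> carrier R" "b \<in> carrier R" "c \<in> carrier R" "d \<in> carrier R"
    and "\<And>K. K \<in> F \<Longrightarrow> \<nu> K a - \<nu> K b = \<nu> K c - \<nu> K d"
  shows "groth_class R (a, b) = groth_class R (c, d)"
  using assms by (simp add: groth_class_eq)

lemma groth_class_self:
  assumes "a \<in> carrier R" "b \<in> carrier R"
  shows "(a, b) \<in> groth_class R (a, b)"
  using assms by (simp add: groth_class_eq)

lemma carrier_groth_ring:
  "carrier (groth_ring R) = {groth_class R (a, b) | a b. a \<in> carrier R \<and> b \<in> carrier R}"
  unfolding groth_ring_def quotient_def groth_class_def by auto

lemma groth_class_closed:
  assumes "a \<in> carrier R" "b \<in> carrier R"
  shows "groth_class R (a, b) \<in> carrier (groth_ring R)"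
  using assms carrier_groth_ring by blast

lemma groth_carrierE:
  assumes "x \<in> carrier (groth_ring R)"
  obtains a b where "a \<in> carrier R" "b \<in> carrier R" "x = groth_class R (a, b)"
  using assms carrier_groth_ring by blast

lemma groth_extend_class:
  assumes "K \<in> F" "a \<in> carrier R" "b \<in> carrier R"
  shows "groth_extend (\<nu> K) (groth_class R (a, b)) = \<nu> K a - \<nu> K b"
  unfolding groth_extend_def
  by (rule the_elem_image_eq[OF groth_class_self[OF assms(2,3)]])
    (use assms in \<open>auto simp: groth_class_eq\<close>)

lemma groth_add_class:
  assumes "a \<in> carrier R" "b \<in> carrier R" "c \<in> carrier R" "d \<in> carrier R"
  shows "groth_class R (a, b) \<oplus>\<^bsub>groth_ring R\<^esub> groth_class R (c, d) = groth_class R (a \<oplus> c, b \<oplus> d)"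
proof -
  have "the_elem ((\<lambda>((a, b), (c, d)). groth_class R (a \<oplus> c, b \<oplus> d)) `
      (groth_class R (a, b) \<times> groth_class R (c, d))) = groth_class R (a \<oplus> c, b \<oplus> d)"
  proof (rule the_elem_image_eq)
    show "((a, b), (c, d)) \<in> groth_class R (a, b) \<times> groth_class R (c, d)"
      using assms groth_class_self by simp
    fix q assume "q \<in> groth_class R (a, b) \<times> groth_class R (c, d)"
    then obtain a' b' c' d' where q: "q = ((a', b'), (c', d'))"
      and ab': "(a', b') \<in> groth_class R (a, b)" and cd': "(c', d') \<in> groth_class R (c, d)"
      by auto
    have "\<nu> K (a' \<oplus> c') - \<nu> K (b' \<oplus> d') = \<nu> K (a \<oplus> c) - \<nu> K (b \<oplus> d)" if K: "K \<in> F" for K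
    proof -
      have "\<nu> K a - \<nu> K b = \<nu> K a' - \<nu> K b'" "\<nu> K c - \<nu> K d = \<nu> K c' - \<nu> K d'"
        using ab' cd' assms K by (simp_all add: groth_class_eq)
      moreover have "a' \<in> carrier R" "b' \<in> carrier R" "c' \<in> carrier R" "d' \<in> carrier R"
        using ab' cd' assms by (simp_all add: groth_class_eq)
      ultimately show ?thesis using assms K by (simp add: mark_add)
    qed
    then have "groth_class R (a' \<oplus> c', b' \<oplus> d') = groth_class R (a \<oplus> c, b \<oplus> d)"
      using ab' cd' assms by (intro groth_class_cong) (simp_all add: groth_class_eq add_closed)
    then show "(\<lambda>((a, b), (c, d)). groth_class R (a \<oplus> c, b \<oplus> d)) q =
        groth_class R (a \<oplus> c, b \<oplus> d)"
      by (simp add: q)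
  qed
  then show ?thesis by (simp add: groth_ring_def)
qed

text \<open>Classes are level sets of mark differences, so these differences separate them. The
  locale is therefore stable under the Grothendieck construction, and the rationalization can start
  from it again.\<close>

lemma groth_marked: "marked_monoid (groth_ring R) (\<lambda>K. groth_extend (\<nu> K)) F"
proof
  show "\<zero>\<^bsub>groth_ring R\<^esub> \<in> carrier (groth_ring R)"
    using groth_class_closed[OF zero_in zero_in] by (simp add: groth_ring_def)
  show "groth_extend (\<nu> K) \<zero>\<^bsub>groth_ring R\<^esub> = 0" if "K \<in> F" for K
    using groth_extend_class[OF that zero_in zero_in] by (simp add: groth_ring_def)
next
  fix x y
  assume xy: "x \<in> carrier (groth_ring R)" "y \<in> carrier (groth_ring R)"
  then obtain a b c d where
    ab: "a \<in> carrier R" "b \<in> carrier R" "x = groth_class R (a, b)" and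
    cd: "c \<in> carrier R" "d \<in> carrier R" "y = groth_class R (c, d)"
    by (metis groth_carrierE)
  show "x \<oplus>\<^bsub>groth_ring R\<^esub> y \<in> carrier (groth_ring R)"
    using ab cd by (simp add: groth_add_class groth_class_closed add_closed)
  show "groth_extend (\<nu> K) (x \<oplus>\<^bsub>groth_ring R\<^esub> y) = groth_extend (\<nu> K) x + groth_extend (\<nu> K) y"
    if "K \<in> F" for K
    using ab cd that by (simp add: groth_add_class groth_extend_class add_closed mark_add)
  show "x = y" if "\<And>K. K \<in> F \<Longrightarrow> groth_extend (\<nu> K) x = groth_extend (\<nu> K) y"
    unfolding ab(3) cd(3) using ab cd that by (intro groth_class_cong) (simp_all add: groth_extend_class)
qed

lemma groth_abelian_group: "abelian_group (groth_ring R)"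
proof -
  interpret groth: marked_monoid "groth_ring R" "\<lambda>K. groth_extend (\<nu> K)" F
    by (rule groth_marked)
  show ?thesis
  proof (rule abelian_groupI)
    fix x assume x: "x \<in> carrier (groth_ring R)"
    then obtain a b where ab: "a \<in> carrier R" "b \<in> carrier R" "x = groth_class R (a, b)"
      by (rule groth_carrierE)
    \<comment> \<open>The inverse of the formal difference \<open>a - b\<close> is
      \<open>b - a\<close>.\<close>
    have "groth_class R (b, a) \<oplus>\<^bsub>groth_ring R\<^esub> x = \<zero>\<^bsub>groth_ring R\<^esub>"
      using ab x by (intro groth.mark_inj groth.add_closed groth_class_closed groth.zero_in)
        (simp_all add: groth.mark_add groth.mark_zero groth_class_closed groth_extend_class)
    then show "\<exists>y\<in>carrier (groth_ring R). y \<oplus>\<^bsub>groth_ring R\<^esub> x = \<zero>\<^bsub>groth_ring R\<^esub>"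
      using ab groth_class_closed by blast
  qed (simp_all add: groth.a_ac groth.add_closed)
qed

end

section \<open>The rationalization of a marked abelian group\<close>

locale marked_group = marked_monoid + abelian_group R
begin

lemma mark_minus:
  assumes "K \<in> F" "a \<in> carrier R"
  shows "\<nu> K (\<ominus> a) = - \<nu> K a"
  using assms mark_add[of K a "\<ominus> a"] by (simp add: r_neg mark_zero)

lemma mark_nat_mult:
  assumes "K \<in> F" "a \<in> carrier R"
  shows "\<nu> K ([n] \<cdot> a) = of_nat n * \<nu> K a"
proof (induction n)
  case (Suc n)
  then show ?case
    using assms add.nat_pow_closed[of a n] by (simp add: mark_add algebra_simps)
qed (simp add: mark_zero assms)

lemma mark_int_mult:
  assumes "K \<in> F" "a \<in> carrier R"
  shows "\<nu> K ([(z::int)] \<cdot> a) = of_int z * \<nu> K a"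
proof (cases "z \<ge> 0")
  case True
  then show ?thesis
    by (simp add: add_pow_int_ge mark_nat_mult[OF assms] of_nat_nat)
next
  case False
  then have "nat (- z) \<ge> 0" "of_nat (nat (- z)) = - (of_int z :: rat)"
    by (simp_all add: of_nat_nat)
  then show ?thesis
    using False assms add.nat_pow_closed
    by (simp add: add_pow_int_lt mark_minus mark_nat_mult)
qed

text \<open>Marks are rational, so the nonzero factor \<open>k\<close> cancels in them; conversely,
  equal fractions of marks give equal multiples already for \<open>k = 1\<close>. Torsion cannot
  occur, and a fraction is determined by its marks.\<close>

lemma rat_class_eq:
  assumes "a \<in> carrier R" "n \<noteq> 0"
  shows "rat_class R (a, n) =
    {(b, m). b \<in> carrier R \<and> m \<noteq> 0 \<and> (\<forall>K\<in>F. \<nu> K a / of_int n = \<nu> K b / of_int m)}"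
proof -
  have *: "(\<exists>k. k \<noteq> 0 \<and> [(k * m)] \<cdot> a = [(k * n)] \<cdot> b) \<longleftrightarrow>
      (\<forall>K\<in>F. \<nu> K a / of_int n = \<nu> K b / of_int m)" (is "?L \<longleftrightarrow> ?R")
    if bm: "b \<in> carrier R" "m \<noteq> 0" for b m
  proof
    assume ?L
    then obtain k :: int where k: "k \<noteq> 0" "[(k * m)] \<cdot> a = [(k * n)] \<cdot> b" by blast
    show ?R
    proof
      fix K assume K: "K \<in> F"
      from k(2) have "\<nu> K ([(k * m)] \<cdot> a) = \<nu> K ([(k * n)] \<cdot> b)" by simp
      then have "of_int k * (of_int m * \<nu> K a) = of_int k * (of_int n * \<nu> K b)"
        by (simp only: mark_int_mult[OF K assms(1)] mark_int_mult[OF K bm(1)] of_int_mult mult.assoc)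
      then show "\<nu> K a / of_int n = \<nu> K b / of_int m"
        using assms(2) bm(2) k(1) by (simp add: frac_eq_eq mult.commute)
    qed
  next
    assume R: ?R
    have "[(1 * m)] \<cdot> a = [(1 * n)] \<cdot> b"
    proof (rule mark_inj)
      fix K assume K: "K \<in> F"
      have "\<nu> K a * of_int m = \<nu> K b * of_int n"
        using R[rule_format, OF K] assms(2) bm(2) by (simp only: frac_eq_eq of_int_eq_0_iff not_False_eq_True)
      then show "\<nu> K ([(1 * m)] \<cdot> a) = \<nu> K ([(1 * n)] \<cdot> b)"
        by (simp add: mark_int_mult[OF K assms(1)] mark_int_mult[OF K bm(1)] mult.commute)
    qed (use assms bm in simp_all)
    then show ?L by (metis one_neq_zero)
  qed
  show ?thesis
  proof (rule Set.set_eqI)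
    fix p :: "'a \<times> int"
    obtain b m where p: "p = (b, m)" by (cases p)
    have "p \<in> rat_class R (a, n) \<longleftrightarrow> b \<in> carrier R \<and> m \<noteq> 0 \<and>
        (\<exists>k. k \<noteq> 0 \<and> [(k * m)] \<cdot> a = [(k * n)] \<cdot> b)"
      unfolding p rat_class_def Image_singleton_iff rat_rel_iff using assms by blast
    then show "p \<in> rat_class R (a, n) \<longleftrightarrow>
        p \<in> {(b, m). b \<in> carrier R \<and> m \<noteq> 0 \<and> (\<forall>K\<in>F. \<nu> K a / of_int n = \<nu> K b / of_int m)}"
      unfolding p using * [of b m] by blast
  qed
qed

lemma rat_class_cong:
  assumes "a \<in> carrier R" "n \<noteq> 0" "b \<in> carrier R" "m \<noteq> 0"
    and "\<And>K. K \<in> F \<Longrightarrow> \<nu> K a / of_int n = \<nu> K b / of_int m"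
  shows "rat_class R (a, n) = rat_class R (b, m)"
  unfolding rat_class_eq[OF assms(1,2)] rat_class_eq[OF assms(3,4)]
  by (simp only: assms(5) cong: ball_cong)

lemma rat_class_self:
  assumes "a \<in> carrier R" "n \<noteq> 0"
  shows "(a, n) \<in> rat_class R (a, n)"
  unfolding rat_class_eq[OF assms] using assms by blast

lemma carrier_rationalization:
  "carrier (rationalization R) = {rat_class R (a, n) | a n. a \<in> carrier R \<and> n \<noteq> 0}"
  unfolding rationalization_def quotient_def rat_class_def by auto

lemma rat_class_closed:
  assumes "a \<in> carrier R" "n \<noteq> 0"
  shows "rat_class R (a, n) \<in> carrier (rationalization R)"
  using assms carrier_rationalization by blast

lemma rat_carrierE:
  assumes "x \<in> carrier (rationalization R)"
  obtains a n where "a \<in> carrier R" "n \<noteq> 0" "x = rat_class R (a, n)"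
  using assms carrier_rationalization by blast

lemma rat_extend_class:
  assumes "K \<in> F" "a \<in> carrier R" "n \<noteq> 0"
  shows "rat_extend (\<nu> K) (rat_class R (a, n)) = \<nu> K a / of_int n"
  unfolding rat_extend_def
proof (rule the_elem_image_eq[OF rat_class_self[OF assms(2,3)]])
  fix p assume "p \<in> rat_class R (a, n)"
  then show "(\<lambda>(a, n). \<nu> K a / of_int n) p = \<nu> K a / of_int n"
    using assms(1) unfolding rat_class_eq[OF assms(2,3)] by force
qed

lemma rat_add_class:
  assumes "a \<in> carrier R" "n \<noteq> 0" "b \<in> carrier R" "m \<noteq> 0"
  shows "rat_class R (a, n) \<oplus>\<^bsub>rationalization R\<^esub> rat_class R (b, m) =
    rat_class R ([m] \<cdot> a \<oplus> [n] \<cdot> b, n * m)"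
proof -
  have "the_elem ((\<lambda>((a, n), (b, m)). rat_class R ([m] \<cdot> a \<oplus> [n] \<cdot> b, n * m)) `
      (rat_class R (a, n) \<times> rat_class R (b, m))) = rat_class R ([m] \<cdot> a \<oplus> [n] \<cdot> b, n * m)"
  proof (rule the_elem_image_eq)
    show "((a, n), (b, m)) \<in> rat_class R (a, n) \<times> rat_class R (b, m)"
      using assms rat_class_self by simp
    fix q assume "q \<in> rat_class R (a, n) \<times> rat_class R (b, m)"
    then obtain a' n' b' m' where q: "q = ((a', n'), (b', m'))"
      and a': "(a', n') \<in> rat_class R (a, n)" and b': "(b', m') \<in> rat_class R (b, m)"
      by auto
    have in_carrier: "a' \<in> carrier R" "b' \<in> carrier R" "n' \<noteq> 0" "m' \<noteq> 0"
      using a' b' unfolding rat_class_eq[OF assms(1,2)] rat_class_eq[OF assms(3,4)] by blast+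
    have "\<nu> K ([m'] \<cdot> a' \<oplus> [n'] \<cdot> b') / of_int (n' * m') = \<nu> K ([m] \<cdot> a \<oplus> [n] \<cdot> b) / of_int (n * m)"
      if K: "K \<in> F" for K
    proof -
      \<comment> \<open>Both sides of the goal are instances of this addition of fractions, so
        representatives enter only through their marks.\<close>
      have *: "\<nu> K ([t] \<cdot> x \<oplus> [s] \<cdot> y) / of_int (s * t) = \<nu> K x / of_int s + \<nu> K y / of_int t"
        if "x \<in> carrier R" "y \<in> carrier R" "s \<noteq> 0" "t \<noteq> 0" for x y and s t :: int
        using that K by (simp add: mark_add mark_int_mult add_divide_distrib)
      have "\<nu> K a / of_int n = \<nu> K a' / of_int n'" "\<nu> K b / of_int m = \<nu> K b' / of_int m'"
        using a' b' assms K unfolding rat_class_eq[OF assms(1,2)] rat_class_eq[OF assms(3,4)] by blast+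
      then show ?thesis
        using in_carrier assms by (simp only: * not_False_eq_True)
    qed
    then have "rat_class R ([m'] \<cdot> a' \<oplus> [n'] \<cdot> b', n' * m') = rat_class R ([m] \<cdot> a \<oplus> [n] \<cdot> b, n * m)"
      using in_carrier assms by (intro rat_class_cong) (simp_all add: add_closed)
    then show "(\<lambda>((a, n), (b, m)). rat_class R ([m] \<cdot> a \<oplus> [n] \<cdot> b, n * m)) q =
        rat_class R ([m] \<cdot> a \<oplus> [n] \<cdot> b, n * m)"
      by (simp add: q)
  qed
  then show ?thesis by (simp add: rationalization_def)
qed

lemma rat_marked: "marked_monoid (rationalization R) (\<lambda>K. rat_extend (\<nu> K)) F"
proof
  show "\<zero>\<^bsub>rationalization R\<^esub> \<in> carrier (rationalization R)"
    using rat_class_closed[OF zero_in, of 1] by (simp add: rationalization_def)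
  show "rat_extend (\<nu> K) \<zero>\<^bsub>rationalization R\<^esub> = 0" if "K \<in> F" for K
    using rat_extend_class[OF that zero_in, of 1] by (simp add: rationalization_def mark_zero that)
next
  fix x y
  assume xy: "x \<in> carrier (rationalization R)" "y \<in> carrier (rationalization R)"
  then obtain a n b m where
    an: "a \<in> carrier R" "n \<noteq> 0" "x = rat_class R (a, n)" and
    bm: "b \<in> carrier R" "m \<noteq> 0" "y = rat_class R (b, m)"
    by (metis rat_carrierE)
  show "x \<oplus>\<^bsub>rationalization R\<^esub> y \<in> carrier (rationalization R)"
    using an bm by (simp add: rat_add_class rat_class_closed add_closed)
  show "rat_extend (\<nu> K) (x \<oplus>\<^bsub>rationalization R\<^esub> y) = rat_extend (\<nu> K) x + rat_extend (\<nu> K) y"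
    if "K \<in> F" for K
    using an bm that
    by (simp add: rat_add_class rat_extend_class add_closed mark_add mark_int_mult add_divide_distrib)
  show "x = y" if eq: "\<And>K. K \<in> F \<Longrightarrow> rat_extend (\<nu> K) x = rat_extend (\<nu> K) y"
  proof -
    have "\<nu> K a / of_int n = \<nu> K b / of_int m" if K: "K \<in> F" for K
      using eq[OF K] by (simp only: an(3) bm(3) rat_extend_class[OF K an(1,2)] rat_extend_class[OF K bm(1,2)])
    then show ?thesis
      unfolding an(3) bm(3) by (rule rat_class_cong[OF an(1,2) bm(1,2)])
  qed
qed

text \<open>For \<open>q = s / t\<close> and \<open>x = a / n\<close> the multiple is
  \<open>(s a) / (t n)\<close>. This supplies the rational scalars with which coset spaces are later
  combined into idempotents.\<close>

lemma rat_scale: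
  assumes "x \<in> carrier (rationalization R)"
  obtains y where "y \<in> carrier (rationalization R)"
    and "\<And>K. K \<in> F \<Longrightarrow> rat_extend (\<nu> K) y = q * rat_extend (\<nu> K) x"
proof -
  obtain a n where an: "a \<in> carrier R" "n \<noteq> 0" "x = rat_class R (a, n)"
    using assms by (rule rat_carrierE)
  obtain s t where "quotient_of q = (s, t)" by (cases "quotient_of q")
  then have st: "q = of_int s / of_int t" "t \<noteq> 0"
    using quotient_of_div[of q s t] quotient_of_denom_pos[of q s t] by auto
  show thesis
  proof (rule that)
    show "rat_class R ([s] \<cdot> a, t * n) \<in> carrier (rationalization R)"
      using an st by (simp add: rat_class_closed)
    show "rat_extend (\<nu> K) (rat_class R ([s] \<cdot> a, t * n)) = q * rat_extend (\<nu> K) x" if "K \<in> F" for K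
      using an st that by (simp add: rat_extend_class mark_int_mult)
  qed
qed

end

text \<open>The index map \<open>h\<close> points backwards: a mark of the image at \<open>K\<close>
  is a mark of the source at \<open>h K\<close>. For the inclusion of Burnside rings,
  \<open>h\<close> is the admissible hull. Additivity of \<open>f\<close> follows, since the marks
  of the target separate its elements.\<close>

locale marked_hom = R: marked_monoid R \<nu> F + S: marked_monoid S \<nu>' F'
  for R (structure) and \<nu> :: "'k \<Rightarrow> 'a \<Rightarrow> rat" and F
    and S (structure) and \<nu>' :: "'l \<Rightarrow> 'b \<Rightarrow> rat" and F' +
  fixes f :: "'a \<Rightarrow> 'b" and h :: "'l \<Rightarrow> 'k"
  assumes hom_closed: "a \<in> carrier R \<Longrightarrow> f a \<in> carrier S"
    and index_closed: "K \<in> F' \<Longrightarrow> h K \<in> F"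
    and mark_hom: "\<lbrakk>K \<in> F'; a \<in> carrier R\<rbrakk> \<Longrightarrow> \<nu>' K (f a) = \<nu> (h K) a"
begin

lemma groth_map_class:
  assumes "a \<in> carrier R" "b \<in> carrier R"
  shows "groth_map S f (groth_class R (a, b)) = groth_class S (f a, f b)"
  unfolding groth_map_def
proof (rule the_elem_image_eq[OF R.groth_class_self[OF assms]])
  fix p assume "p \<in> groth_class R (a, b)"
  then obtain c d where p: "p = (c, d)" "c \<in> carrier R" "d \<in> carrier R"
    and eq: "\<And>K. K \<in> F \<Longrightarrow> \<nu> K a - \<nu> K b = \<nu> K c - \<nu> K d"
    unfolding R.groth_class_eq[OF assms] by blast
  have "groth_class S (f c, f d) = groth_class S (f a, f b)"
    using assms p eq[OF index_closed] by (intro S.groth_class_cong) (simp_all add: hom_closed mark_hom)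
  then show "(\<lambda>(a, b). groth_class S (f a, f b)) p = groth_class S (f a, f b)"
    by (simp add: p)
qed

text \<open>Marks of formal differences are differences of marks, so compatibility with
  \<open>h\<close> lifts. Together with \<open>rat_hom\<close> this carries a statement about
  isomorphism classes to the rational Burnside rings.\<close>

lemma groth_hom:
  "marked_hom (groth_ring R) (\<lambda>K. groth_extend (\<nu> K)) F
    (groth_ring S) (\<lambda>K. groth_extend (\<nu>' K)) F' (groth_map S f) h"
proof (intro marked_hom.intro marked_hom_axioms.intro R.groth_marked S.groth_marked index_closed)
  fix x assume "x \<in> carrier (groth_ring R)"
  then obtain a b where ab: "a \<in> carrier R" "b \<in> carrier R" "x = groth_class R (a, b)"
    by (rule R.groth_carrierE)
  show "groth_map S f x \<in> carrier (groth_ring S)"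
    using ab by (simp add: groth_map_class S.groth_class_closed hom_closed)
  show "groth_extend (\<nu>' K) (groth_map S f x) = groth_extend (\<nu> (h K)) x" if "K \<in> F'" for K
    using ab that
    by (simp add: groth_map_class S.groth_extend_class R.groth_extend_class hom_closed mark_hom index_closed)
qed

end

locale marked_group_hom = marked_hom + R: abelian_group R + S: abelian_group S
begin

sublocale R: marked_group R \<nu> F ..
sublocale S: marked_group S \<nu>' F' ..

lemma rat_map_class:
  assumes "a \<in> carrier R" "n \<noteq> 0"
  shows "rat_map S f (rat_class R (a, n)) = rat_class S (f a, n)"
  unfolding rat_map_def
proof (rule the_elem_image_eq[OF R.rat_class_self[OF assms]])
  fix p assume "p \<in> rat_class R (a, n)"
  then obtain b m where p: "p = (b, m)" "b \<in> carrier R" "m \<noteq> 0"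
    and eq: "\<And>K. K \<in> F \<Longrightarrow> \<nu> K a / of_int n = \<nu> K b / of_int m"
    unfolding R.rat_class_eq[OF assms] by blast
  have "rat_class S (f a, n) = rat_class S (f b, m)"
    using assms p eq[OF index_closed] by (intro S.rat_class_cong) (simp_all add: hom_closed mark_hom)
  then show "(\<lambda>(a, n). rat_class S (f a, n)) p = rat_class S (f a, n)"
    by (simp add: p)
qed

lemma rat_hom:
  "marked_hom (rationalization R) (\<lambda>K. rat_extend (\<nu> K)) F
    (rationalization S) (\<lambda>K. rat_extend (\<nu>' K)) F' (rat_map S f) h"
proof (intro marked_hom.intro marked_hom_axioms.intro R.rat_marked S.rat_marked index_closed)
  fix x assume "x \<in> carrier (rationalization R)"
  then obtain a n where an: "a \<in> carrier R" "n \<noteq> 0" "x = rat_class R (a, n)"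
    by (rule R.rat_carrierE)
  show "rat_map S f x \<in> carrier (rationalization S)"
    using an by (simp add: rat_map_class S.rat_class_closed hom_closed)
  show "rat_extend (\<nu>' K) (rat_map S f x) = rat_extend (\<nu> (h K)) x" if "K \<in> F'" for K
    using an that
    by (simp add: rat_map_class S.rat_extend_class R.rat_extend_class hom_closed mark_hom index_closed)
qed

end

section \<open>Finite G-sets with prescribed isotropy\<close>

text \<open>Each map is bijective because the inverse group element acts as its inverse.
  Extensionality turns the pointwise multiplication law into an equality in
  \<open>BijGroup X\<close>.\<close>

lemma group_actionI:
  fixes G (structure)
  assumes "group G"
    and ext: "\<And>g. g \<in> carrier G \<Longrightarrow> \<phi> g \<in> extensional X"
    and closed: "\<And>g x. \<lbrakk>g \<in> carrier G; x \<in> X\<rbrakk> \<Longrightarrow> \<phi> g x \<in> X"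
    and one: "\<And>x. x \<in> X \<Longrightarrow> \<phi> \<one> x = x"
    and mult: "\<And>g h x. \<lbrakk>g \<in> carrier G; h \<in> carrier G; x \<in> X\<rbrakk> \<Longrightarrow> \<phi> (g \<otimes> h) x = \<phi> g (\<phi> h x)"
  shows "group_action G X \<phi>"
proof -
  interpret group G by fact
  have Bij: "\<phi> g \<in> Bij X" if g: "g \<in> carrier G" for g
  proof -
    have "bij_betw (\<phi> g) X X"
      by (rule bij_betw_byWitness[where f' = "\<phi> (inv g)"])
        (use g in \<open>auto simp: closed one simp flip: mult\<close>)
    with ext[OF g] show ?thesis by (simp add: Bij_def)
  qed
  have "\<phi> (g \<otimes> h) = compose X (\<phi> g) (\<phi> h)" if "g \<in> carrier G" "h \<in> carrier G" for g h
    using that by (intro extensionalityI[of _ X]) (auto simp: ext mult compose_def)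
  then have "\<phi> \<in> hom G (BijGroup X)"
    by (auto simp: hom_def BijGroup_def Bij)
  then show ?thesis
    using group_BijGroup assms(1)
    by (simp add: group_action_def group_hom_def group_hom_axioms_def)
qed

text \<open>The condition is put on stabilizers of points rather than on orbits, so that it can be
  checked pointwise on disjoint unions and isomorphic copies. The underlying type is arbitrary, so
  sums and coset spaces qualify before they are copied to the natural numbers.\<close>

definition isotropy_in :: "('g, 'm) monoid_scheme \<Rightarrow> 'g set set \<Rightarrow> ('g, 'x) gset \<Rightarrow> bool" where
  "isotropy_in G F = (\<lambda>(X, \<phi>). is_finite_gset G (X, \<phi>) \<and> (\<forall>x\<in>X. stabilizer G \<phi> x \<in> F))"

definition isotropy_gsets :: "('g, 'm) monoid_scheme \<Rightarrow> 'g set set \<Rightarrow> ('g, nat) gset set" where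
  "isotropy_gsets G F = {T. isotropy_in G F T}"

lemma isotropy_in_finite: "isotropy_in G F S \<Longrightarrow> is_finite_gset G S"
  by (cases S) (simp add: isotropy_in_def)

lemma gset_one: "\<lbrakk>group_action G X \<phi>; x \<in> X\<rbrakk> \<Longrightarrow> \<phi> \<one>\<^bsub>G\<^esub> x = x"
  by (metis group_action.id_eq_one restrict_apply')

lemma gset_closed: "\<lbrakk>group_action G X \<phi>; g \<in> carrier G; x \<in> X\<rbrakk> \<Longrightarrow> \<phi> g x \<in> X"
  by (rule group_action.element_image[of G X \<phi> g x]) auto

lemma finite_gset_stabilizer:
  "is_finite_gset G (X, \<phi>) \<Longrightarrow> x \<in> X \<Longrightarrow> stabilizer G \<phi> x \<in> subgroups G"
  by (auto simp: is_finite_gset_def subgroups_def intro: group_action.stabilizer_subgroup)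

text \<open>Stabilizers are always subgroups, so the classical Burnside ring is the case where the
  family consists of all subgroups.\<close>

lemma finite_gsets_eq: "finite_gsets G = isotropy_gsets G (subgroups G)"
  unfolding finite_gsets_def isotropy_gsets_def isotropy_in_def
  using finite_gset_stabilizer by fastforce

section \<open>Isomorphisms of G-sets and isomorphism classes\<close>

lemma gset_isoE:
  assumes "gset_iso G (X, \<phi>) (Y, \<psi>)"
  obtains f where "bij_betw f X Y" "\<And>g x. \<lbrakk>g \<in> carrier G; x \<in> X\<rbrakk> \<Longrightarrow> f (\<phi> g x) = \<psi> g (f x)"
  using assms unfolding gset_iso_def by auto

lemma gset_isoI:
  assumes "bij_betw f X Y" "\<And>g x. \<lbrakk>g \<in> carrier G; x \<in> X\<rbrakk> \<Longrightarrow> f (\<phi> g x) = \<psi> g (f x)"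
  shows "gset_iso G (X, \<phi>) (Y, \<psi>)"
  using assms unfolding gset_iso_def by auto

lemma gset_iso_refl: "gset_iso G S S"
  by (cases S) (auto intro!: gset_isoI[of id])

text \<open>The definition of \<open>gset_iso\<close> asks nothing of the two actions. Closure of
  the source under its action is what makes the inverse bijection equivariant.\<close>

lemma gset_iso_sym:
  assumes "is_finite_gset G S" "gset_iso G S T"
  shows "gset_iso G T S"
proof -
  obtain X \<phi> Y \<psi> where ST: "S = (X, \<phi>)" "T = (Y, \<psi>)" by (metis surj_pair)
  then have act: "group_action G X \<phi>" using assms(1) by (simp add: is_finite_gset_def)
  obtain f where f: "bij_betw f X Y"
    "\<And>g x. \<lbrakk>g \<in> carrier G; x \<in> X\<rbrakk> \<Longrightarrow> f (\<phi> g x) = \<psi> g (f x)"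
    using assms(2) unfolding ST by (rule gset_isoE) (rule that)
  have "inv_into X f (\<psi> g y) = \<phi> g (inv_into X f y)" if g: "g \<in> carrier G" and "y \<in> Y" for g y
  proof -
    obtain x where x: "x \<in> X" "y = f x" using f(1) \<open>y \<in> Y\<close> by (auto simp: bij_betw_def)
    then show ?thesis
      using f(1) gset_closed[OF act g] f(2)[OF g x(1), symmetric]
      by (simp add: bij_betw_def inv_into_f_f)
  qed
  then show ?thesis
    unfolding ST using bij_betw_inv_into[OF f(1)] by (intro gset_isoI)
qed

lemma gset_iso_trans:
  assumes "gset_iso G S T" "gset_iso G T U"
  shows "gset_iso G S U"
proof -
  obtain X \<phi> Y \<psi> Z \<chi> where eq: "S = (X, \<phi>)" "T = (Y, \<psi>)" "U = (Z, \<chi>)"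
    by (metis surj_pair)
  obtain f where f: "bij_betw f X Y"
    "\<And>g x. \<lbrakk>g \<in> carrier G; x \<in> X\<rbrakk> \<Longrightarrow> f (\<phi> g x) = \<psi> g (f x)"
    using assms(1) unfolding eq by (rule gset_isoE) (rule that)
  obtain h where h: "bij_betw h Y Z"
    "\<And>g y. \<lbrakk>g \<in> carrier G; y \<in> Y\<rbrakk> \<Longrightarrow> h (\<psi> g y) = \<chi> g (h y)"
    using assms(2) unfolding eq by (rule gset_isoE) (rule that)
  show ?thesis
    unfolding eq using f h bij_betw_apply[OF f(1)]
    by (intro gset_isoI[of "h \<circ> f"]) (auto intro: bij_betw_trans)
qed

lemma stabilizer_equivariant:
  assumes "inj_on f X" "x \<in> X" "\<And>g. g \<in> carrier G \<Longrightarrow> \<phi> g x \<in> X"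
    and "\<And>g. g \<in> carrier G \<Longrightarrow> f (\<phi> g x) = \<psi> g (f x)"
  shows "stabilizer G \<psi> (f x) = stabilizer G \<phi> x"
  using assms unfolding stabilizer_def by (metis (no_types, lifting) inj_on_eq_iff)

lemma isotropy_in_iso:
  assumes "isotropy_in G F S" "is_finite_gset G T" "gset_iso G S T"
  shows "isotropy_in G F T"
proof -
  obtain X \<phi> Y \<psi> where eq: "S = (X, \<phi>)" "T = (Y, \<psi>)"
    by (metis surj_pair)
  obtain f where f: "bij_betw f X Y"
    "\<And>g x. \<lbrakk>g \<in> carrier G; x \<in> X\<rbrakk> \<Longrightarrow> f (\<phi> g x) = \<psi> g (f x)"
    using assms(3) unfolding eq by (rule gset_isoE) (rule that)
  have act: "group_action G X \<phi>" using assms(1) by (simp add: eq is_finite_gset_def isotropy_in_def)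
  have "stabilizer G \<psi> y \<in> F" if "y \<in> Y" for y
  proof -
    obtain x where x: "x \<in> X" "y = f x" using f(1) \<open>y \<in> Y\<close> by (auto simp: bij_betw_def)
    have "stabilizer G \<psi> y = stabilizer G \<phi> x"
      unfolding x(2) using f x(1) gset_closed[OF act]
      by (intro stabilizer_equivariant[of f X]) (auto simp: bij_betw_def)
    then show ?thesis using assms(1) x(1) by (simp add: eq isotropy_in_def)
  qed
  then show ?thesis using assms(2) by (simp add: eq isotropy_in_def)
qed

lemma card_fixed_points_iso:
  assumes "is_finite_gset G S" "gset_iso G S T" "K \<subseteq> carrier G"
  shows "card (fixed_points K S) = card (fixed_points K T)"
proof -
  obtain X \<phi> Y \<psi> where eq: "S = (X, \<phi>)" "T = (Y, \<psi>)"
    by (metis surj_pair)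
  obtain f where f: "bij_betw f X Y"
    "\<And>g x. \<lbrakk>g \<in> carrier G; x \<in> X\<rbrakk> \<Longrightarrow> f (\<phi> g x) = \<psi> g (f x)"
    using assms(2) unfolding eq by (rule gset_isoE) (rule that)
  have act: "group_action G X \<phi>" using assms(1) by (simp add: eq is_finite_gset_def)
  have "\<psi> k (f x) = f x \<longleftrightarrow> \<phi> k x = x" if "k \<in> K" "x \<in> X" for k x
    using f that assms(3) gset_closed[OF act, of k x]
    by (metis bij_betw_def inj_on_eq_iff subsetD)
  then have "f ` fixed_points K S = fixed_points K T"
    using f(1) unfolding eq fixed_points_def bij_betw_def by auto
  moreover have "inj_on f (fixed_points K S)"
    using f(1) unfolding eq fixed_points_def bij_betw_def by (auto intro: inj_on_subset)
  ultimately show ?thesis by (metis card_image)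
qed

lemma iso_class_self: "is_finite_gset G S \<Longrightarrow> S \<in> iso_class G S"
  by (simp add: iso_class_def finite_gsets_def gset_iso_refl)

lemma iso_class_eqI:
  assumes "is_finite_gset G S" "gset_iso G S T"
  shows "iso_class G S = iso_class G T"
  unfolding iso_class_def
  using assms gset_iso_sym gset_iso_trans by (metis (no_types, lifting))

text \<open>Isomorphism classes contain only sets of natural numbers. Transport of structure along
  an enumeration shows that the class of a finite \<open>G\<close>-set over any type is
  inhabited.\<close>

lemma ex_nat_copy:
  fixes G :: "('g, 'm) monoid_scheme" (structure)
  assumes "isotropy_in G F S"
  obtains T :: "('g, nat) gset" where "isotropy_in G F T" "gset_iso G S T"
proof -
  obtain X \<phi> where S: "S = (X, \<phi>)" by (cases S)
  have act: "group_action G X \<phi>" and fin: "finite X"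
    using assms by (simp_all add: S isotropy_in_def is_finite_gset_def)
  interpret group G using act by (simp add: group_action_def group_hom_def)
  obtain f where f: "bij_betw f X {0..<card X}"
    using ex_bij_betw_finite_nat[OF fin] by blast
  define Y where "Y = {0..<card X}"
  \<comment> \<open>The transported action is restricted to \<open>Y\<close> because action maps
    have to be extensional.\<close>
  define \<psi> where "\<psi> g = restrict (f \<circ> \<phi> g \<circ> inv_into X f) Y" for g
  have f: "bij_betw f X Y" using f by (simp add: Y_def)
  have inv: "inv_into X f (f x) = x" if "x \<in> X" for x
    using f that by (simp add: bij_betw_def)
  have mem: "f x \<in> Y" if "x \<in> X" for x
    using f that by (auto simp: bij_betw_def)
  have eqv: "f (\<phi> g x) = \<psi> g (f x)" if "x \<in> X" for g x
    using that by (simp add: \<psi>_def inv mem)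
  have Y: "\<exists>x\<in>X. y = f x" if "y \<in> Y" for y
    using f that by (auto simp: bij_betw_def)
  have "group_action G Y \<psi>"
  proof (rule group_actionI)
    fix g h y assume g: "g \<in> carrier G" and h: "h \<in> carrier G" and "y \<in> Y"
    then obtain x where x: "x \<in> X" "y = f x" using Y by blast
    show "\<psi> (g \<otimes> h) y = \<psi> g (\<psi> h y)"
      using x g h gset_closed[OF act] group_action.composition_rule[OF act]
      by (simp flip: eqv)
  next
    fix g y assume g: "g \<in> carrier G" and "y \<in> Y"
    then obtain x where x: "x \<in> X" "y = f x" using Y by blast
    then show "\<psi> g y \<in> Y" using gset_closed[OF act g] by (simp add: mem flip: eqv)
  next
    fix y assume "y \<in> Y"
    then obtain x where x: "x \<in> X" "y = f x" using Y by blast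
    then show "\<psi> \<one> y = y" using gset_one[OF act] by (simp flip: eqv)
  qed (simp_all add: is_group \<psi>_def)
  then have "is_finite_gset G (Y, \<psi>)" by (simp add: is_finite_gset_def Y_def)
  moreover have "gset_iso G S (Y, \<psi>)"
    unfolding S using f eqv by (intro gset_isoI)
  ultimately show thesis using that isotropy_in_iso assms by blast
qed

text \<open>This is the innermost function of \<open>marks\<close>, isolated because it takes the
  role of \<open>\<nu>\<close> on isomorphism classes.\<close>

definition mark :: "'g set \<Rightarrow> ('g, nat) gset set \<Rightarrow> rat" where
  "mark K a = the_elem ((\<lambda>T. of_nat (card (fixed_points K T))) ` a)"

lemma marks_eq: "marks F x = (\<lambda>K\<in>F. rat_extend (groth_extend (mark K)) x)"
  unfolding marks_def mark_def ..

text \<open>Isomorphic \<open>G\<close>-sets have equally many \<open>K\<close>-fixed points;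
  equivariance only speaks about elements of the group, hence the condition on \<open>K\<close>. A
  copy over the natural numbers makes the class nonempty, as \<open>the_elem\<close>
  requires.\<close>

lemma mark_iso_class:
  fixes G :: "('g, 'm) monoid_scheme"
  assumes "isotropy_in G F S" "K \<subseteq> carrier G"
  shows "mark K (iso_class G S) = of_nat (card (fixed_points K S))"
proof -
  obtain T :: "('g, nat) gset" where T: "isotropy_in G F T" "gset_iso G S T"
    using assms(1) by (rule ex_nat_copy)
  then have "T \<in> iso_class G S"
    by (simp add: iso_class_def finite_gsets_def isotropy_in_finite)
  then show ?thesis
    unfolding mark_def
  proof (rule the_elem_image_eq)
    fix U assume "U \<in> iso_class G S"
    then show "of_nat (card (fixed_points K U)) = of_nat (card (fixed_points K S))"
      using card_fixed_points_iso[of G S U K] assms by (simp add: iso_class_def isotropy_in_finite)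
  qed
qed

section \<open>Disjoint unions and the semiring of isomorphism classes\<close>

lemma isotropy_in_sum:
  assumes "isotropy_in G F S" "isotropy_in G F T"
  shows "isotropy_in G F (gset_sum S T)"
proof -
  obtain X \<phi> Y \<psi> where eq: "S = (X, \<phi>)" "T = (Y, \<psi>)"
    by (metis surj_pair)
  have act: "group_action G X \<phi>" "group_action G Y \<psi>" and "finite X" "finite Y"
    using assms by (simp_all add: eq isotropy_in_def is_finite_gset_def)
  interpret group G using act by (simp add: group_action_def group_hom_def)
  define \<chi> where "\<chi> g = restrict (map_sum (\<phi> g) (\<psi> g)) (X <+> Y)" for g
  have Inl: "\<chi> g (Inl x) = Inl (\<phi> g x)" if "x \<in> X" for g x
    using that by (auto simp: \<chi>_def)
  have Inr: "\<chi> g (Inr y) = Inr (\<psi> g y)" if "y \<in> Y" for g y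
    using that by (auto simp: \<chi>_def)
  have "group_action G (X <+> Y) \<chi>"
  proof (rule group_actionI)
    show "\<chi> g \<in> extensional (X <+> Y)" for g by (simp add: \<chi>_def)
  qed (use act in \<open>auto simp: Inl Inr is_group gset_one gset_closed group_action.composition_rule\<close>)
  moreover have "stabilizer G \<chi> (Inl x) = stabilizer G \<phi> x" if "x \<in> X" for x
    using that by (simp add: stabilizer_def Inl)
  moreover have "stabilizer G \<chi> (Inr y) = stabilizer G \<psi> y" if "y \<in> Y" for y
    using that by (simp add: stabilizer_def Inr)
  ultimately have "isotropy_in G F (X <+> Y, \<chi>)"
    using assms \<open>finite X\<close> \<open>finite Y\<close>
    by (auto simp: eq isotropy_in_def is_finite_gset_def)
  moreover have "gset_sum S T = (X <+> Y, \<chi>)"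
    by (simp add: eq gset_sum_def \<chi>_def[abs_def])
  ultimately show ?thesis by simp
qed

lemma card_fixed_points_sum:
  assumes "is_finite_gset G S" "is_finite_gset G T"
  shows "card (fixed_points K (gset_sum S T)) = card (fixed_points K S) + card (fixed_points K T)"
proof -
  obtain X \<phi> Y \<psi> where eq: "S = (X, \<phi>)" "T = (Y, \<psi>)"
    by (metis surj_pair)
  have "fixed_points K (gset_sum S T) = fixed_points K S <+> fixed_points K T"
    by (auto simp: eq gset_sum_def fixed_points_def)
  moreover have "finite (fixed_points K S)" "finite (fixed_points K T)"
    using assms by (simp_all add: eq fixed_points_def is_finite_gset_def)
  ultimately show ?thesis by (simp add: card_Plus)
qed

lemma gset_sum_iso:
  assumes "gset_iso G S S'" "gset_iso G T T'"
  shows "gset_iso G (gset_sum S T) (gset_sum S' T')"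
proof -
  obtain X \<phi> Y \<psi> X' \<phi>' Y' \<psi>' where eq: "S = (X, \<phi>)" "T = (Y, \<psi>)" "S' = (X', \<phi>')" "T' = (Y', \<psi>')"
    by (metis surj_pair)
  obtain f where f: "bij_betw f X X'"
    "\<And>g x. \<lbrakk>g \<in> carrier G; x \<in> X\<rbrakk> \<Longrightarrow> f (\<phi> g x) = \<phi>' g (f x)"
    using assms(1) unfolding eq by (rule gset_isoE) (rule that)
  obtain h where h: "bij_betw h Y Y'"
    "\<And>g y. \<lbrakk>g \<in> carrier G; y \<in> Y\<rbrakk> \<Longrightarrow> h (\<psi> g y) = \<psi>' g (h y)"
    using assms(2) unfolding eq by (rule gset_isoE) (rule that)
  have "bij_betw (map_sum f h) (X <+> Y) (X' <+> Y')"
    unfolding bij_betw_def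
  proof
    show "inj_on (map_sum f h) (X <+> Y)"
      using bij_betw_imp_inj_on[OF f(1)] bij_betw_imp_inj_on[OF h(1)]
      by (intro inj_onI) (auto dest: inj_onD)
    have "map_sum f h ` (X <+> Y) = f ` X <+> h ` Y"
      by (simp add: Plus_def image_Un image_image)
    then show "map_sum f h ` (X <+> Y) = X' <+> Y'"
      using bij_betw_imp_surj_on[OF f(1)] bij_betw_imp_surj_on[OF h(1)] by simp
  qed
  then show ?thesis
    unfolding eq gset_sum_def prod.case
    using f(2) h(2) bij_betw_apply[OF f(1)] bij_betw_apply[OF h(1)]
    by (intro gset_isoI[of "map_sum f h"]) auto
qed

lemma isotropy_in_empty: "group G \<Longrightarrow> isotropy_in G F gset_empty"
  unfolding isotropy_in_def gset_empty_def is_finite_gset_def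
  by (auto intro: group_actionI)

text \<open>The addition of \<open>gset_semiring\<close> does not mention \<open>\<C>\<close>, so
  one formula serves the admissible and the full semiring.\<close>

lemma gset_semiring_add:
  fixes S T :: "('g, nat) gset"
  assumes "isotropy_in G F S" "isotropy_in G F T"
  shows "iso_class G S \<oplus>\<^bsub>gset_semiring G \<C>\<^esub> iso_class G T = iso_class G (gset_sum S T)"
proof -
  have fin: "is_finite_gset G S" "is_finite_gset G T" "is_finite_gset G (gset_sum S T)"
    using assms isotropy_in_sum isotropy_in_finite by blast+
  have "the_elem ((\<lambda>(S, T). iso_class G (gset_sum S T)) ` (iso_class G S \<times> iso_class G T)) =
      iso_class G (gset_sum S T)"
  proof (rule the_elem_image_eq)
    show "(S, T) \<in> iso_class G S \<times> iso_class G T"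
      using fin by (simp add: iso_class_self)
    fix p assume "p \<in> iso_class G S \<times> iso_class G T"
    then obtain S' T' where p: "p = (S', T')" "gset_iso G S S'" "gset_iso G T T'"
      by (auto simp: iso_class_def)
    then show "(\<lambda>(S, T). iso_class G (gset_sum S T)) p = iso_class G (gset_sum S T)"
      using iso_class_eqI[OF fin(3) gset_sum_iso[OF p(2,3)]] by simp
  qed
  then show ?thesis by (simp add: gset_semiring_def)
qed

lemma iso_class_in_semiring:
  fixes G :: "('g, 'm) monoid_scheme"
  assumes "isotropy_in G F S"
  shows "iso_class G S \<in> carrier (gset_semiring G (isotropy_gsets G F))"
proof -
  obtain T :: "('g, nat) gset" where T: "isotropy_in G F T" "gset_iso G S T"
    using assms by (rule ex_nat_copy)
  then have "iso_class G S = iso_class G T"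
    using assms by (intro iso_class_eqI isotropy_in_finite)
  then show ?thesis using T(1) by (auto simp: gset_semiring_def isotropy_gsets_def)
qed

lemma semiring_carrierE:
  fixes G :: "('g, 'm) monoid_scheme"
  assumes "a \<in> carrier (gset_semiring G (isotropy_gsets G F))"
  obtains S :: "('g, nat) gset" where "isotropy_in G F S" "a = iso_class G S"
proof -
  have "a \<in> iso_class G ` {S :: ('g, nat) gset. isotropy_in G F S}"
    using assms by (simp add: gset_semiring_def isotropy_gsets_def)
  then show thesis using that by blast
qed

section \<open>Burnside's theorem on marks\<close>

lemma (in group_action) action_eq_iff:
  assumes "x \<in> E" "g \<in> carrier G" "h \<in> carrier G"
  shows "\<phi> g x = \<phi> h x \<longleftrightarrow> inv h \<otimes> g \<in> stabilizer G \<phi> x"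
proof -
  interpret group G using group_hom by (simp add: group_hom_def)
  have "\<phi> (inv h \<otimes> g) x = \<phi> (inv h) (\<phi> g x)"
    using assms by (simp add: composition_rule)
  moreover have "\<phi> (inv h) (\<phi> h x) = x" using assms orbit_sym_aux by blast
  moreover have "\<phi> h (\<phi> (inv h) (\<phi> g x)) = \<phi> g x"
    using assms composition_rule[of "\<phi> g x" h "inv h"] element_image[of g x] id_eq_one
    by (metis inv_closed r_inv restrict_apply')
  ultimately show ?thesis using assms by (auto simp: stabilizer_def)
qed

text \<open>Both orbits are quotients of the group by the same stabilizer, so sending
  \<open>\<phi> g x\<close> to \<open>\<psi> g y\<close> is well defined and injective.\<close>

lemma orbit_iso:
  fixes G (structure)
  assumes X: "group_action G X \<phi>" and Y: "group_action G Y \<psi>" and "x \<in> X" "y \<in> Y"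
    and stab: "stabilizer G \<phi> x = stabilizer G \<psi> y"
  obtains f where "bij_betw f (orbit G \<phi> x) (orbit G \<psi> y)"
    "\<And>g z. \<lbrakk>g \<in> carrier G; z \<in> orbit G \<phi> x\<rbrakk> \<Longrightarrow> f (\<phi> g z) = \<psi> g (f z)"
proof -
  interpret X: group_action G X \<phi> by fact
  interpret Y: group_action G Y \<psi> by fact
  interpret group G using X.group_hom by (simp add: group_hom_def)
  \<comment> \<open>The value does not depend on which element carrying \<open>x\<close> to
    \<open>z\<close> is chosen, by \<open>key\<close>.\<close>
  define f where "f z = \<psi> (SOME g. g \<in> carrier G \<and> \<phi> g x = z) y" for z
  have key: "\<phi> g x = \<phi> h x \<longleftrightarrow> \<psi> g y = \<psi> h y" if "g \<in> carrier G" "h \<in> carrier G" for g h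
    using X.action_eq_iff[of x g h] Y.action_eq_iff[of y g h] that assms by simp
  have f: "f (\<phi> g x) = \<psi> g y" if g: "g \<in> carrier G" for g
  proof -
    have "(SOME h. h \<in> carrier G \<and> \<phi> h x = \<phi> g x) \<in> carrier G \<and>
        \<phi> (SOME h. h \<in> carrier G \<and> \<phi> h x = \<phi> g x) x = \<phi> g x"
      by (rule someI[of _ g]) (simp add: g)
    then show ?thesis unfolding f_def using key g by blast
  qed
  have inj: "inj_on f (orbit G \<phi> x)"
    by (auto simp: inj_on_def orbit_def f key)
  have img: "f ` orbit G \<phi> x = orbit G \<psi> y"
    unfolding orbit_def using f by (auto simp: image_iff) (metis f)
  show thesis
  proof (rule that[of f])
    show "bij_betw f (orbit G \<phi> x) (orbit G \<psi> y)" using inj img by (simp add: bij_betw_def)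
    show "f (\<phi> g z) = \<psi> g (f z)" if g: "g \<in> carrier G" and z: "z \<in> orbit G \<phi> x" for g z
    proof -
      obtain h where h: "h \<in> carrier G" "z = \<phi> h x" using z by (auto simp: orbit_def)
      have "f (\<phi> g z) = f (\<phi> (g \<otimes> h) x)"
        using g h assms by (simp add: X.composition_rule)
      also have "\<dots> = \<psi> g (f z)"
        using g h assms by (simp add: f Y.composition_rule)
      finally show ?thesis .
    qed
  qed
qed

text \<open>Induction on the number of points, splitting off one orbit on each side. Invariant
  subsets of two fixed \<open>G\<close>-sets are used so that the actions stay the same when an
  orbit is removed.\<close>

lemma ex_equivariant_bij:
  fixes G (structure)
  assumes X: "group_action G X \<phi>" and Y: "group_action G Y \<psi>"
    and fin: "finite X" "finite Y" "finite F" and F: "\<And>K. K \<in> F \<Longrightarrow> K \<subseteq> carrier G"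
    and "X' \<subseteq> X" "Y' \<subseteq> Y"
    and "\<And>g x. \<lbrakk>g \<in> carrier G; x \<in> X'\<rbrakk> \<Longrightarrow> \<phi> g x \<in> X'"
    and "\<And>g y. \<lbrakk>g \<in> carrier G; y \<in> Y'\<rbrakk> \<Longrightarrow> \<psi> g y \<in> Y'"
    and "\<And>x. x \<in> X' \<Longrightarrow> stabilizer G \<phi> x \<in> F"
    and "\<And>y. y \<in> Y' \<Longrightarrow> stabilizer G \<psi> y \<in> F"
    and "\<And>K. K \<in> F \<Longrightarrow> card {x \<in> X'. \<forall>k\<in>K. \<phi> k x = x} = card {y \<in> Y'. \<forall>k\<in>K. \<psi> k y = y}"
  shows "\<exists>f. bij_betw f X' Y' \<and> (\<forall>g\<in>carrier G. \<forall>x\<in>X'. f (\<phi> g x) = \<psi> g (f x))"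
  using assms(7-)
proof (induction "card X'" arbitrary: X' Y' rule: less_induct)
  case less
  note X'X = less.prems(1) and Y'Y = less.prems(2) and clX = less.prems(3) and clY = less.prems(4)
    and stX = less.prems(5) and stY = less.prems(6) and marks = less.prems(7)
  interpret X: group_action G X \<phi> by fact
  interpret Y: group_action G Y \<psi> by fact
  interpret group G using X.group_hom by (simp add: group_hom_def)
  have finX': "finite X'" and finY': "finite Y'"
    using fin X'X Y'Y finite_subset by auto
  \<comment> \<open>Equal marks vanish together, so a member of \<open>F\<close> fixes a point on
    one side iff it does on the other.\<close>
  have trans: "(\<exists>x\<in>X'. \<forall>k\<in>K. \<phi> k x = x) \<longleftrightarrow> (\<exists>y\<in>Y'. \<forall>k\<in>K. \<psi> k y = y)" if "K \<in> F" for K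
  proof -
    have "card {x \<in> X'. \<forall>k\<in>K. \<phi> k x = x} = 0 \<longleftrightarrow> card {y \<in> Y'. \<forall>k\<in>K. \<psi> k y = y} = 0"
      using marks[OF that] by simp
    then show ?thesis using finX' finY' by auto
  qed
  show ?case
  proof (cases "X' = {}")
    case True
    have "Y' = {}"
    proof (rule ccontr)
      assume "Y' \<noteq> {}"
      then obtain y where y: "y \<in> Y'" by blast
      then have "\<forall>k\<in>stabilizer G \<psi> y. \<psi> k y = y" by (simp add: stabilizer_def)
      then show False using trans[OF stY[OF y]] y True by blast
    qed
    with True show ?thesis by (simp add: bij_betw_def)
  next
    case False
    \<comment> \<open>A maximal member of \<open>P\<close> is the full stabilizer of every point it
      fixes, in \<open>X'\<close> and in \<open>Y'\<close>. Hence the two orbits chosen below are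
      isomorphic.\<close>
    define P where "P = {K \<in> F. \<exists>x\<in>X'. \<forall>k\<in>K. \<phi> k x = x}"
    obtain x0 where "x0 \<in> X'" using False by blast
    then have "stabilizer G \<phi> x0 \<in> P"
      using stX by (auto simp: P_def stabilizer_def)
    then have "finite P" "P \<noteq> {}" using fin(3) by (auto simp: P_def)
    from finite_has_maximal[OF this] obtain K
      where K: "K \<in> P" and max: "\<And>L. L \<in> P \<Longrightarrow> K \<subseteq> L \<Longrightarrow> K = L"
      by blast
    have KF: "K \<in> F" using K by (simp add: P_def)
    obtain x where x: "x \<in> X'" "\<forall>k\<in>K. \<phi> k x = x" using K by (auto simp: P_def)
    obtain y where y: "y \<in> Y'" "\<forall>k\<in>K. \<psi> k y = y" using trans[OF KF] x by blast
    have "stabilizer G \<phi> x \<in> P" using x stX by (auto simp: P_def stabilizer_def)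
    then have Kx: "K = stabilizer G \<phi> x"
      using x F[OF KF] by (intro max) (auto simp: stabilizer_def)
    \<comment> \<open>By \<open>trans\<close> the stabilizer of \<open>y\<close> also fixes a point
      of \<open>X'\<close>, so maximality of \<open>K\<close> applies to it too.\<close>
    have "stabilizer G \<psi> y \<in> P"
      using y(1) stY[OF y(1)] trans[OF stY[OF y(1)]] by (auto simp: P_def stabilizer_def)
    then have Ky: "K = stabilizer G \<psi> y"
      using y F[OF KF] by (intro max) (auto simp: stabilizer_def)
    have xX: "x \<in> X" and yY: "y \<in> Y" using x y X'X Y'Y by auto
    obtain f1 where f1: "bij_betw f1 (orbit G \<phi> x) (orbit G \<psi> y)"
      "\<And>g z. \<lbrakk>g \<in> carrier G; z \<in> orbit G \<phi> x\<rbrakk> \<Longrightarrow> f1 (\<phi> g z) = \<psi> g (f1 z)"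
      using orbit_iso[OF X Y xX yY] Kx Ky by metis
    have orbX: "orbit G \<phi> x \<subseteq> X'" and orbY: "orbit G \<psi> y \<subseteq> Y'"
      using clX clY x y by (auto simp: orbit_def)
    have xin: "x \<in> orbit G \<phi> x" using xX by (rule X.orbit_refl)
    have orb_closedX: "\<phi> g z \<in> orbit G \<phi> x \<longleftrightarrow> z \<in> orbit G \<phi> x" if "g \<in> carrier G" "z \<in> X'" for g z
    proof -
      have z: "z \<in> X" "\<phi> g z \<in> X" using that X'X clX by auto
      have "\<phi> g z \<in> orbit G \<phi> z" using that by (auto simp: orbit_def)
      then show ?thesis
        using X.orbit_trans[of x z "\<phi> g z"] X.orbit_trans[of x "\<phi> g z" z] X.orbit_sym[of z "\<phi> g z"] z xX
        by blast
    qed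
    have orb_closedY: "\<psi> g z \<in> orbit G \<psi> y \<longleftrightarrow> z \<in> orbit G \<psi> y" if "g \<in> carrier G" "z \<in> Y'" for g z
    proof -
      have z: "z \<in> Y" "\<psi> g z \<in> Y" using that Y'Y clY by auto
      have "\<psi> g z \<in> orbit G \<psi> z" using that by (auto simp: orbit_def)
      then show ?thesis
        using Y.orbit_trans[of y z "\<psi> g z"] Y.orbit_trans[of y "\<psi> g z" z] Y.orbit_sym[of z "\<psi> g z"] z yY
        by blast
    qed
    have card_less: "card (X' - orbit G \<phi> x) < card X'"
      using finX' x xin by (intro psubset_card_mono) auto
    \<comment> \<open>The bijection \<open>f1\<close> matches the fixed points in the two orbits, so
      removing the orbits lowers the marks on both sides equally.\<close>
    have rest: "card {z \<in> X' - orbit G \<phi> x. \<forall>k\<in>L. \<phi> k z = z} =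
        card {z \<in> Y' - orbit G \<psi> y. \<forall>k\<in>L. \<psi> k z = z}" if L: "L \<in> F" for L
    proof -
      let ?A = "{z \<in> orbit G \<phi> x. \<forall>k\<in>L. \<phi> k z = z}"
      let ?B = "{z \<in> orbit G \<psi> y. \<forall>k\<in>L. \<psi> k z = z}"
      have "\<psi> k (f1 z) = f1 z \<longleftrightarrow> \<phi> k z = z" if "k \<in> L" "z \<in> orbit G \<phi> x" for k z
      proof -
        have k: "k \<in> carrier G" using that F[OF L] by blast
        have "\<phi> k z \<in> orbit G \<phi> x" using orb_closedX[OF k] that orbX by blast
        then show ?thesis
          using f1(2)[OF k that(2)] inj_on_eq_iff[OF bij_betw_imp_inj_on[OF f1(1)], of "\<phi> k z" z] that(2)
          by simp
      qed
      then have img: "f1 ` ?A = ?B"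
        using bij_betw_imp_surj_on[OF f1(1), symmetric] by auto
      have "inj_on f1 ?A"
        using bij_betw_imp_inj_on[OF f1(1)] by (rule inj_on_subset) auto
      from card_image[OF this] have AB: "card ?A = card ?B" unfolding img by (rule sym)
      have "{z \<in> X' - orbit G \<phi> x. \<forall>k\<in>L. \<phi> k z = z} = {z \<in> X'. \<forall>k\<in>L. \<phi> k z = z} - ?A"
        "{z \<in> Y' - orbit G \<psi> y. \<forall>k\<in>L. \<psi> k z = z} = {z \<in> Y'. \<forall>k\<in>L. \<psi> k z = z} - ?B"
        by auto
      moreover have "?A \<subseteq> {z \<in> X'. \<forall>k\<in>L. \<phi> k z = z}" "?B \<subseteq> {z \<in> Y'. \<forall>k\<in>L. \<psi> k z = z}"
        using orbX orbY by auto
      moreover have "finite ?A" "finite ?B"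
        using finX' finY' orbX orbY by (auto intro: finite_subset)
      ultimately show ?thesis
        using AB marks[OF L] by (simp add: card_Diff_subset)
    qed
    have "\<exists>f. bij_betw f (X' - orbit G \<phi> x) (Y' - orbit G \<psi> y) \<and>
        (\<forall>g\<in>carrier G. \<forall>z\<in>X' - orbit G \<phi> x. f (\<phi> g z) = \<psi> g (f z))"
      using X'X Y'Y clX clY stX stY orb_closedX orb_closedY rest
      by (intro less.hyps card_less) auto
    then obtain f2 where f2: "bij_betw f2 (X' - orbit G \<phi> x) (Y' - orbit G \<psi> y)"
      "\<And>g z. \<lbrakk>g \<in> carrier G; z \<in> X' - orbit G \<phi> x\<rbrakk> \<Longrightarrow> f2 (\<phi> g z) = \<psi> g (f2 z)"
      by blast
    let ?f = "\<lambda>z. if z \<in> orbit G \<phi> x then f1 z else f2 z"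
    have "bij_betw ?f (orbit G \<phi> x \<union> (X' - orbit G \<phi> x)) (orbit G \<psi> y \<union> (Y' - orbit G \<psi> y))"
      by (rule bij_betw_disjoint_Un[OF f1(1) f2(1)]) auto
    then have "bij_betw ?f X' Y'" using orbX orbY by (simp add: Un_absorb1)
    moreover have "?f (\<phi> g z) = \<psi> g (?f z)" if "g \<in> carrier G" "z \<in> X'" for g z
      using that f1(2) f2(2) orb_closedX[OF that] by auto
    ultimately show ?thesis by blast
  qed
qed

theorem gset_iso_if_equal_marks:
  fixes G (structure)
  assumes S: "isotropy_in G F S" and T: "isotropy_in G F T"
    and F: "finite F" "\<And>K. K \<in> F \<Longrightarrow> K \<subseteq> carrier G"
    and eq: "\<And>K. K \<in> F \<Longrightarrow> card (fixed_points K S) = card (fixed_points K T)"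
  shows "gset_iso G S T"
proof -
  obtain X \<phi> Y \<psi> where ST: "S = (X, \<phi>)" "T = (Y, \<psi>)" by (metis surj_pair)
  have act: "group_action G X \<phi>" "group_action G Y \<psi>" and fin: "finite X" "finite Y"
    and st: "\<And>x. x \<in> X \<Longrightarrow> stabilizer G \<phi> x \<in> F" "\<And>y. y \<in> Y \<Longrightarrow> stabilizer G \<psi> y \<in> F"
    using S T by (simp_all add: ST isotropy_in_def is_finite_gset_def)
  have "\<exists>f. bij_betw f X Y \<and> (\<forall>g\<in>carrier G. \<forall>x\<in>X. f (\<phi> g x) = \<psi> g (f x))"
    using gset_closed[OF act(1)] gset_closed[OF act(2)] st eq
    by (intro ex_equivariant_bij[OF act fin F]) (auto simp: ST fixed_points_def)
  then show ?thesis by (simp add: ST gset_iso_def)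
qed

section \<open>Conjugation and coset spaces\<close>

context group
begin

lemma mult_inv_cancel:
  assumes "g \<in> carrier G" "x \<in> carrier G"
  shows "g \<otimes> (inv g \<otimes> x) = x" "inv g \<otimes> (g \<otimes> x) = x"
  using assms by (simp_all flip: m_assoc)

lemma conj_eq_image:
  assumes "H \<subseteq> carrier G" "g \<in> carrier G"
  shows "g <# H #> inv g = (\<lambda>h. g \<otimes> h \<otimes> inv g) ` H"
  by (auto simp: l_coset_def r_coset_def)

lemma conj_closed_carrier:
  assumes "H \<subseteq> carrier G" "g \<in> carrier G"
  shows "g <# H #> inv g \<subseteq> carrier G"
  using assms by (auto simp: conj_eq_image)

lemma mem_conj_iff:
  assumes "H \<subseteq> carrier G" "g \<in> carrier G" "x \<in> carrier G"
  shows "x \<in> g <# H #> inv g \<longleftrightarrow> inv g \<otimes> x \<otimes> g \<in> H"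
proof
  assume "x \<in> g <# H #> inv g"
  then obtain h where h: "h \<in> H" "x = g \<otimes> h \<otimes> inv g" using assms by (auto simp: conj_eq_image)
  then have "inv g \<otimes> x \<otimes> g = h" using assms by (simp add: subset_iff m_assoc mult_inv_cancel)
  then show "inv g \<otimes> x \<otimes> g \<in> H" using h by simp
next
  assume "inv g \<otimes> x \<otimes> g \<in> H"
  moreover have "x = g \<otimes> (inv g \<otimes> x \<otimes> g) \<otimes> inv g"
    using assms by (simp add: m_assoc mult_inv_cancel)
  ultimately show "x \<in> g <# H #> inv g" using assms by (auto simp: conj_eq_image)
qed

lemma conj_conj:
  assumes "H \<subseteq> carrier G" "g \<in> carrier G" "h \<in> carrier G"
  shows "g <# (h <# H #> inv h) #> inv g = (g \<otimes> h) <# H #> inv (g \<otimes> h)"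
proof -
  have "g \<otimes> (h \<otimes> x \<otimes> inv h) \<otimes> inv g = (g \<otimes> h) \<otimes> x \<otimes> inv (g \<otimes> h)" if "x \<in> H" for x
    using assms that by (simp add: subset_iff m_assoc inv_mult_group)
  moreover have "g <# (h <# H #> inv h) #> inv g = (\<lambda>x. g \<otimes> (h \<otimes> x \<otimes> inv h) \<otimes> inv g) ` H"
    by (subst conj_eq_image[OF conj_closed_carrier[OF assms(1,3)] assms(2)])
      (simp only: conj_eq_image[OF assms(1,3)] image_image)
  moreover have "(g \<otimes> h) <# H #> inv (g \<otimes> h) = (\<lambda>x. (g \<otimes> h) \<otimes> x \<otimes> inv (g \<otimes> h)) ` H"
    using assms by (intro conj_eq_image) auto
  ultimately show ?thesis by auto
qed

lemma conj_one: "H \<subseteq> carrier G \<Longrightarrow> \<one> <# H #> inv \<one> = H"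
  by (simp add: lcos_mult_one)

lemma conj_mono: "H \<subseteq> K \<Longrightarrow> g <# H #> inv g \<subseteq> g <# K #> inv g"
  by (auto simp: l_coset_def r_coset_def)

lemma conj_inv_cancel:
  assumes "H \<subseteq> carrier G" "g \<in> carrier G"
  shows "inv g <# (g <# H #> inv g) #> inv (inv g) = H" "g <# (inv g <# H #> inv (inv g)) #> inv g = H"
  using assms conj_one[of H] conj_conj[of H "inv g" g] conj_conj[of H g "inv g"] by simp_all

lemma card_conj:
  assumes "H \<subseteq> carrier G" "g \<in> carrier G"
  shows "card (g <# H #> inv g) = card H"
  unfolding conj_eq_image[OF assms] using assms
  by (intro card_image inj_onI) (simp add: subset_iff)

lemma conj_class_self: "H \<subseteq> carrier G \<Longrightarrow> H \<in> conj_class G H"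
  unfolding conj_class_def by (rule image_eqI[where x = \<one>]) (simp_all only: conj_one one_closed)

lemma conj_class_eq:
  assumes "H \<subseteq> carrier G" "K \<in> conj_class G H"
  shows "conj_class G K = conj_class G H"
proof -
  obtain g where g: "g \<in> carrier G" "K = g <# H #> inv g"
    using assms(2) by (auto simp: conj_class_def)
  show ?thesis
  proof (intro equalityI subsetI)
    fix L assume "L \<in> conj_class G K"
    then obtain h where h: "h \<in> carrier G" "L = h <# K #> inv h" by (auto simp: conj_class_def)
    then have "L = (h \<otimes> g) <# H #> inv (h \<otimes> g)" using g assms(1) by (simp only: conj_conj)
    then show "L \<in> conj_class G H" using g(1) h(1) unfolding conj_class_def by blast
  next
    fix L assume "L \<in> conj_class G H"
    then obtain h where h: "h \<in> carrier G" "L = h <# H #> inv h" by (auto simp: conj_class_def)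
    have "L = h <# (inv g <# K #> inv (inv g)) #> inv h"
      unfolding h(2) g(2) conj_inv_cancel(1)[OF assms(1) g(1)] ..
    then have "L = (h \<otimes> inv g) <# K #> inv (h \<otimes> inv g)"
      using conj_conj[OF _ h(1) inv_closed[OF g(1)], of K] conj_closed_carrier[OF assms(1) g(1)]
      unfolding g(2) by simp
    then show "L \<in> conj_class G K"
      using g(1) h(1) unfolding conj_class_def by blast
  qed
qed

lemma conj_class_sym:
  "\<lbrakk>H \<subseteq> carrier G; K \<in> conj_class G H\<rbrakk> \<Longrightarrow> H \<in> conj_class G K"
  using conj_class_eq conj_class_self by blast

lemma conj_subgroup:
  assumes "subgroup H G" "g \<in> carrier G"
  shows "subgroup (g <# H #> inv g) G"
proof -
  interpret H: subgroup H G by fact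
  have H: "H \<subseteq> carrier G" by (rule H.subset)
  show ?thesis
  proof (rule subgroupI)
    show "g <# H #> inv g \<subseteq> carrier G" using H assms(2) by (rule conj_closed_carrier)
    show "g <# H #> inv g \<noteq> {}" 
      using H.one_closed by (simp only: conj_eq_image[OF H assms(2)]) blast
    fix a b assume "a \<in> g <# H #> inv g" "b \<in> g <# H #> inv g"
    then obtain x y where xy: "x \<in> H" "y \<in> H" "a = g \<otimes> x \<otimes> inv g" "b = g \<otimes> y \<otimes> inv g"
      using H assms(2) by (auto simp: conj_eq_image)
    have "inv a = g \<otimes> inv x \<otimes> inv g" using xy assms(2) by (simp add: inv_mult_group m_assoc)
    then show "inv a \<in> g <# H #> inv g" using xy H assms(2) by (simp add: conj_eq_image)
    have "a \<otimes> b = g \<otimes> (x \<otimes> y) \<otimes> inv g"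
      using xy assms(2) by (simp add: m_assoc mult_inv_cancel)
    then show "a \<otimes> b \<in> g <# H #> inv g" using xy H assms(2) by (simp add: conj_eq_image)
  qed
qed

section \<open>The action on a coset space and its stabilizers\<close>

lemma coset_gset_action:
  assumes K: "subgroup K G"
  shows "group_action G (lcosets K) (\<lambda>g. \<lambda>C \<in> lcosets K. g <# C)"
proof (rule group_actionI)
  have sub: "K \<subseteq> carrier G" using K by (rule subgroup.subset)
  have cl: "g <# C \<in> lcosets K" if "g \<in> carrier G" "C \<in> lcosets K" for g C
    using that sub by (auto simp: LCOSETS_def lcos_m_assoc)
  show "(\<lambda>C \<in> lcosets K. g <# C) C \<in> lcosets K" if "g \<in> carrier G" "C \<in> lcosets K" for g C
    using cl that by simp
  have C: "C \<subseteq> carrier G" if "C \<in> lcosets K" for C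
    using that sub by (auto simp: LCOSETS_def l_coset_def)
  show "(\<lambda>C \<in> lcosets K. \<one> <# C) C = C" if "C \<in> lcosets K" for C
    using C that by (simp add: lcos_mult_one)
  show "(\<lambda>C \<in> lcosets K. (g \<otimes> h) <# C) C = (\<lambda>C \<in> lcosets K. g <# C) ((\<lambda>C \<in> lcosets K. h <# C) C)"
    if "g \<in> carrier G" "h \<in> carrier G" "C \<in> lcosets K" for g h C
    using C cl that by (simp add: lcos_m_assoc)
qed (simp_all add: is_group)

text \<open>An element \<open>h\<close> fixes \<open>g <# K\<close> iff
  \<open>inv g \<otimes> h \<otimes> g\<close> lies in \<open>K\<close>. All conjugates of
  \<open>K\<close> thus occur as stabilizers in its coset space, which is why families of isotropy
  groups are taken closed under conjugation.\<close>

lemma coset_stabilizer: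
  assumes K: "subgroup K G" and g: "g \<in> carrier G"
  shows "stabilizer G (\<lambda>g. \<lambda>C \<in> lcosets K. g <# C) (g <# K) = g <# K #> inv g"
proof -
  have sub: "K \<subseteq> carrier G" using K by (rule subgroup.subset)
  have gK: "g <# K \<in> lcosets K" using g by (auto simp: LCOSETS_def)
  have "h <# (g <# K) = g <# K \<longleftrightarrow> h \<in> g <# K #> inv g" if h: "h \<in> carrier G" for h
  proof -
    have "h <# (g <# K) = (h \<otimes> g) <# K" using sub g h by (simp add: lcos_m_assoc)
    also have "\<dots> = g <# K \<longleftrightarrow> inv g \<otimes> (h \<otimes> g) \<in> K"
    proof
      assume "(h \<otimes> g) <# K = g <# K"
      then have "h \<otimes> g \<in> g <# K" using lcos_self[OF _ K, of "h \<otimes> g"] g h by simp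
      then show "inv g \<otimes> (h \<otimes> g) \<in> K" by (rule subgroup.lcos_module_imp[OF K is_group g])
    next
      assume "inv g \<otimes> (h \<otimes> g) \<in> K"
      then have "h \<otimes> g \<in> g <# K"
        using g h mult_inv_cancel(1)[of g "h \<otimes> g"] unfolding l_coset_def by force
      then show "(h \<otimes> g) <# K = g <# K" using l_repr_independence[OF _ g K] by simp
    qed
    also have "\<dots> \<longleftrightarrow> h \<in> g <# K #> inv g"
      using mem_conj_iff[OF sub g h] g h by (simp add: m_assoc)
    finally show ?thesis .
  qed
  moreover have "g <# K #> inv g \<subseteq> carrier G" using sub g by (rule conj_closed_carrier)
  ultimately show ?thesis using gK by (auto simp: stabilizer_def)
qed

end

section \<open>The marks isomorphism\<close>

locale subgroup_family = group G for G (structure) +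
  fixes F :: "'a set set"
  assumes finite_carrier: "finite (carrier G)"
    and family_subgroups: "F \<subseteq> subgroups G"
    and family_conj: "\<lbrakk>H \<in> F; g \<in> carrier G\<rbrakk> \<Longrightarrow> g <# H #> inv g \<in> F"
begin

lemma family_subgroup: "H \<in> F \<Longrightarrow> subgroup H G"
  using family_subgroups by (auto simp: subgroups_def)

lemma family_subset: "H \<in> F \<Longrightarrow> H \<subseteq> carrier G"
  using family_subgroup subgroup.subset by blast

lemma finite_family: "finite F"
  by (rule finite_subset[of _ "Pow (carrier G)"]) (use family_subset finite_carrier in auto)

lemma conj_class_subset: "H \<in> F \<Longrightarrow> conj_class G H \<subseteq> F"
  by (auto simp: conj_class_def family_conj)

lemma isotropy_in_coset:
  assumes "K \<in> F"
  shows "isotropy_in G F (coset_gset G K)"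
proof -
  have K: "subgroup K G" using assms by (rule family_subgroup)
  have "finite (lcosets K)" by (simp add: LCOSETS_def finite_carrier)
  moreover have "stabilizer G (\<lambda>g. \<lambda>C \<in> lcosets K. g <# C) C \<in> F" if C: "C \<in> lcosets K" for C
  proof -
    obtain g where "g \<in> carrier G" "C = g <# K" using C by (auto simp: LCOSETS_def)
    then show ?thesis using coset_stabilizer[OF K] family_conj[OF assms] by simp
  qed
  ultimately show ?thesis
    using coset_gset_action[OF K] by (simp add: isotropy_in_def is_finite_gset_def coset_gset_def)
qed

text \<open>The orbit of \<open>x\<close> is the coset space of its stabilizer; conversely,
  stabilizers in a coset space of \<open>K\<close> are conjugates of \<open>K\<close> and remain in
  \<open>F\<close>. With \<open>F\<close> the admissible subgroups, the right-hand side is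
  \<open>admissible_gsets\<close>.\<close>

lemma isotropy_gsets_eq_orbit_condition:
  "isotropy_gsets G F = {(X, \<phi>) \<in> finite_gsets G. \<forall>U \<in> orbits G X \<phi>.
     \<exists>K \<in> F. gset_iso G (U, \<lambda>g. restrict (\<phi> g) U) (coset_gset G K)}"
proof -
  have "(\<forall>x\<in>X. stabilizer G \<phi> x \<in> F) \<longleftrightarrow>
      (\<forall>U \<in> orbits G X \<phi>. \<exists>K \<in> F. gset_iso G (U, \<lambda>g. restrict (\<phi> g) U) (coset_gset G K))"
    (is "?L \<longleftrightarrow> ?R") if fin: "is_finite_gset G (X, \<phi>)" for X :: "nat set" and \<phi>
  proof -
    have act: "group_action G X \<phi>" using fin by (simp add: is_finite_gset_def)
    interpret X: group_action G X \<phi> by (rule act)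
    show ?thesis
    proof
      assume L: ?L
      show ?R
      proof
        fix U assume "U \<in> orbits G X \<phi>"
        then obtain x where x: "x \<in> X" "U = orbit G \<phi> x" by (auto simp: orbits_def)
        define K where "K = stabilizer G \<phi> x"
        have KF: "K \<in> F" using L x by (simp add: K_def)
        have K: "subgroup K G" using KF by (rule family_subgroup)
        let ?\<psi> = "\<lambda>g. \<lambda>C \<in> lcosets K. g <# C"
        \<comment> \<open>The coset \<open>K\<close> itself is the base point: its stabilizer is
          \<open>K\<close>, so \<open>orbit_iso\<close> compares its orbit with that of
          \<open>x\<close>.\<close>
        have K1: "\<one> <# K = K" using family_subset[OF KF] by (rule lcos_mult_one)
        have K1in: "K \<in> lcosets K" unfolding LCOSETS_def using K1 by force
        have "stabilizer G ?\<psi> K = K"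
          using coset_stabilizer[OF K one_closed] conj_one[OF family_subset[OF KF]] by (simp only: K1)
        then obtain f where f: "bij_betw f (orbit G \<phi> x) (orbit G ?\<psi> K)"
          "\<And>g z. \<lbrakk>g \<in> carrier G; z \<in> orbit G \<phi> x\<rbrakk> \<Longrightarrow> f (\<phi> g z) = ?\<psi> g (f z)"
          using orbit_iso[OF act coset_gset_action[OF K] x(1) K1in] by (metis K_def)
        have "orbit G ?\<psi> K = lcosets K"
          using K1in by (auto simp: orbit_def LCOSETS_def)
        with f have "gset_iso G (U, \<lambda>g. restrict (\<phi> g) U) (coset_gset G K)"
          unfolding coset_gset_def x(2) by (intro gset_isoI[of f]) auto
        then show "\<exists>K \<in> F. gset_iso G (U, \<lambda>g. restrict (\<phi> g) U) (coset_gset G K)"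
          using KF by blast
      qed
    next
      assume R: ?R
      show ?L
      proof
        fix x assume x: "x \<in> X"
        let ?U = "orbit G \<phi> x"
        have "?U \<in> orbits G X \<phi>" using x by (auto simp: orbits_def)
        then obtain K where K: "K \<in> F" "gset_iso G (?U, \<lambda>g. restrict (\<phi> g) ?U) (coset_gset G K)"
          using R by blast
        let ?\<psi> = "\<lambda>g. \<lambda>C \<in> lcosets K. g <# C"
        obtain f where f: "bij_betw f ?U (lcosets K)"
          "\<And>g z. \<lbrakk>g \<in> carrier G; z \<in> ?U\<rbrakk> \<Longrightarrow> f (restrict (\<phi> g) ?U z) = ?\<psi> g (f z)"
          using K(2) unfolding coset_gset_def by (rule gset_isoE) (rule that)
        have xU: "x \<in> ?U" using x by (rule X.orbit_refl)
        have cl: "\<phi> g x \<in> ?U" if "g \<in> carrier G" for g using that by (auto simp: orbit_def)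
        have eqv: "f (\<phi> g x) = ?\<psi> g (f x)" if "g \<in> carrier G" for g
          using f(2)[OF that xU] xU by simp
        have "stabilizer G ?\<psi> (f x) = stabilizer G \<phi> x"
          using bij_betw_imp_inj_on[OF f(1)] xU cl eqv by (rule stabilizer_equivariant)
        moreover have "f x \<in> lcosets K" using f(1) xU by (rule bij_betw_apply)
        then have "stabilizer G ?\<psi> (f x) \<in> F"
          using isotropy_in_coset[OF K(1)] by (simp add: isotropy_in_def coset_gset_def)
        ultimately show "stabilizer G \<phi> x \<in> F" by (simp only:)
      qed
    qed
  qed
  then show ?thesis
    unfolding isotropy_gsets_def finite_gsets_def isotropy_in_def by blast
qed

text \<open>The condition \<open>mark_inj\<close> is the injectivity half of Burnside's theorem,
  given by \<open>gset_iso_if_equal_marks\<close>. The abstract results on differences and fractions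
  now apply.\<close>

sublocale S: marked_monoid "gset_semiring G (isotropy_gsets G F)" mark F
proof
  show zero: "\<zero>\<^bsub>gset_semiring G (isotropy_gsets G F)\<^esub> \<in> carrier (gset_semiring G (isotropy_gsets G F))"
    using iso_class_in_semiring[of G F "gset_empty :: ('a, nat) gset", OF isotropy_in_empty[OF is_group]]
    by (simp add: gset_semiring_def)
  show "mark K \<zero>\<^bsub>gset_semiring G (isotropy_gsets G F)\<^esub> = 0" if "K \<in> F" for K
    using mark_iso_class[of G F "gset_empty :: ('a, nat) gset",
        OF isotropy_in_empty[OF is_group] family_subset[OF that]]
    by (simp add: gset_semiring_def fixed_points_def gset_empty_def)
next
  fix a b
  assume "a \<in> carrier (gset_semiring G (isotropy_gsets G F))"
    "b \<in> carrier (gset_semiring G (isotropy_gsets G F))"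
  then obtain S T :: "('a, nat) gset" where S: "isotropy_in G F S" "a = iso_class G S"
    and T: "isotropy_in G F T" "b = iso_class G T"
    by (metis semiring_carrierE)
  have ST: "isotropy_in G F (gset_sum S T)" using S(1) T(1) by (rule isotropy_in_sum)
  show "a \<oplus>\<^bsub>gset_semiring G (isotropy_gsets G F)\<^esub> b \<in> carrier (gset_semiring G (isotropy_gsets G F))"
    unfolding S(2) T(2) gset_semiring_add[OF S(1) T(1)] by (rule iso_class_in_semiring[OF ST])
  show "mark K (a \<oplus>\<^bsub>gset_semiring G (isotropy_gsets G F)\<^esub> b) = mark K a + mark K b"
    if K: "K \<in> F" for K
    unfolding S(2) T(2) gset_semiring_add[OF S(1) T(1)]
    using card_fixed_points_sum[OF isotropy_in_finite[OF S(1)] isotropy_in_finite[OF T(1)], of K]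
    by (simp add: mark_iso_class[OF S(1) family_subset[OF K]] mark_iso_class[OF T(1) family_subset[OF K]]
        mark_iso_class[OF ST family_subset[OF K]])
  show "a = b" if eq: "\<And>K. K \<in> F \<Longrightarrow> mark K a = mark K b"
  proof -
    have "card (fixed_points K S) = card (fixed_points K T)" if K: "K \<in> F" for K
      using eq[OF K] mark_iso_class[OF S(1) family_subset[OF K]] mark_iso_class[OF T(1) family_subset[OF K]]
      by (simp add: S(2) T(2))
    then have "gset_iso G S T"
      by (intro gset_iso_if_equal_marks[OF S(1) T(1) finite_family] family_subset)
    then show ?thesis
      unfolding S(2) T(2) by (rule iso_class_eqI[OF isotropy_in_finite[OF S(1)]])
  qed
qed

sublocale Gr: marked_group "groth_ring (gset_semiring G (isotropy_gsets G F))"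
  "\<lambda>K. groth_extend (mark K)" F
  by (intro marked_group.intro S.groth_marked S.groth_abelian_group)

sublocale B: marked_monoid "rational_gset_ring G (isotropy_gsets G F)"
  "\<lambda>K. rat_extend (groth_extend (mark K))" F
  unfolding rational_gset_ring_def by (rule Gr.rat_marked)

text \<open>Membership in the image of the marks, where only values on \<open>F\<close> count. The
  image is shown to be a rational vector space containing the marks of every coset space of a member
  of \<open>F\<close>.\<close>

definition realized :: "('a set \<Rightarrow> rat) \<Rightarrow> bool" where
  "realized v \<longleftrightarrow> (\<exists>x \<in> carrier (rational_gset_ring G (isotropy_gsets G F)).
     \<forall>K\<in>F. rat_extend (groth_extend (mark K)) x = v K)"

lemma realized_cong:
  assumes "realized v" "\<And>K. K \<in> F \<Longrightarrow> v K = w K"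
  shows "realized w"
  using assms by (auto simp: realized_def)

lemma realized_zero: "realized (\<lambda>K. 0)"
  using B.zero_in B.mark_zero by (auto simp: realized_def)

lemma realized_add:
  assumes "realized v" "realized w"
  shows "realized (\<lambda>K. v K + w K)"
proof -
  obtain x y where
    "x \<in> carrier (rational_gset_ring G (isotropy_gsets G F))"
    "\<And>K. K \<in> F \<Longrightarrow> rat_extend (groth_extend (mark K)) x = v K"
    "y \<in> carrier (rational_gset_ring G (isotropy_gsets G F))"
    "\<And>K. K \<in> F \<Longrightarrow> rat_extend (groth_extend (mark K)) y = w K"
    using assms by (auto simp: realized_def)
  then show ?thesis
    unfolding realized_def using B.add_closed B.mark_add
    by (intro bexI[of _ "x \<oplus>\<^bsub>rational_gset_ring G (isotropy_gsets G F)\<^esub> y"]) auto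
qed

lemma realized_scale:
  assumes "realized v"
  shows "realized (\<lambda>K. q * v K)"
proof -
  obtain x where x: "x \<in> carrier (rational_gset_ring G (isotropy_gsets G F))"
    "\<And>K. K \<in> F \<Longrightarrow> rat_extend (groth_extend (mark K)) x = v K"
    using assms by (auto simp: realized_def)
  obtain y where "y \<in> carrier (rational_gset_ring G (isotropy_gsets G F))"
    "\<And>K. K \<in> F \<Longrightarrow> rat_extend (groth_extend (mark K)) y = q * rat_extend (groth_extend (mark K)) x"
    using Gr.rat_scale[of x q] x(1) unfolding rational_gset_ring_def by blast
  then show ?thesis using x(2) by (auto simp: realized_def)
qed

lemma realized_sum:
  assumes "finite A" "\<And>i. i \<in> A \<Longrightarrow> realized (v i)"
  shows "realized (\<lambda>K. \<Sum>i\<in>A. v i K)"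
  using assms
  by (induction A rule: finite_induct) (simp_all add: realized_zero realized_add)

lemma realized_coset:
  assumes "H \<in> F"
  shows "realized (\<lambda>K. of_nat (card (fixed_points K (coset_gset G H))))"
proof -
  let ?S = "gset_semiring G (isotropy_gsets G F)"
  define a where "a = iso_class G (coset_gset G H)"
  have iso: "isotropy_in G F (coset_gset G H)" using assms by (rule isotropy_in_coset)
  have a: "a \<in> carrier ?S" unfolding a_def using iso by (rule iso_class_in_semiring)
  \<comment> \<open>The coset space, seen as a formal difference with zero over the denominator
    one.\<close>
  define x where "x = rat_class (groth_ring ?S) (groth_class ?S (a, \<zero>\<^bsub>?S\<^esub>), 1)"
  have c: "groth_class ?S (a, \<zero>\<^bsub>?S\<^esub>) \<in> carrier (groth_ring ?S)"
    using a S.zero_in by (rule S.groth_class_closed)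
  have "x \<in> carrier (rational_gset_ring G (isotropy_gsets G F))"
    unfolding x_def rational_gset_ring_def using c by (rule Gr.rat_class_closed) simp
  moreover have "rat_extend (groth_extend (mark K)) x = of_nat (card (fixed_points K (coset_gset G H)))"
    if K: "K \<in> F" for K
  proof -
    have "rat_extend (groth_extend (mark K)) x = mark K a"
      unfolding x_def
      by (simp add: Gr.rat_extend_class[OF K c] S.groth_extend_class[OF K a S.zero_in] S.mark_zero[OF K])
    then show ?thesis
      unfolding a_def mark_iso_class[OF iso family_subset[OF K]] .
  qed
  ultimately show ?thesis by (auto simp: realized_def)
qed

section \<open>Marks at conjugate subgroups and the marks of coset spaces\<close>

lemma card_fixed_points_conj:
  assumes "group_action G X \<phi>" "g \<in> carrier G" "K \<subseteq> carrier G"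
  shows "card (fixed_points (g <# K #> inv g) (X, \<phi>)) = card (fixed_points K (X, \<phi>))"
proof -
  interpret X: group_action G X \<phi> by fact
  have fix_iff: "(\<phi> (g \<otimes> k \<otimes> inv g) (\<phi> g x) = \<phi> g x) \<longleftrightarrow> \<phi> k x = x" if "x \<in> X" "k \<in> K" for x k
  proof -
    have k: "k \<in> carrier G" using that assms(3) by blast
    have kx: "\<phi> k x \<in> X" by (rule gset_closed[OF assms(1) k that(1)])
    have "\<phi> (g \<otimes> k \<otimes> inv g) (\<phi> g x) = \<phi> ((g \<otimes> k \<otimes> inv g) \<otimes> g) x"
      using that k assms(2) by (simp only: X.composition_rule m_closed inv_closed)
    also have "(g \<otimes> k \<otimes> inv g) \<otimes> g = g \<otimes> k" using k assms(2) by (simp add: m_assoc)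
    also have "\<phi> (g \<otimes> k) x = \<phi> g (\<phi> k x)" using that k assms(2) by (simp add: X.composition_rule)
    finally show ?thesis
      using inj_on_eq_iff[OF X.inj_prop[OF assms(2)] kx that(1)] by simp
  qed
  \<comment> \<open>Translation by \<open>g\<close> carries the points fixed by \<open>K\<close>
    onto those fixed by the conjugate.\<close>
  have "fixed_points (g <# K #> inv g) (X, \<phi>) = \<phi> g ` fixed_points K (X, \<phi>)"
  proof (intro equalityI subsetI)
    fix y assume y: "y \<in> fixed_points (g <# K #> inv g) (X, \<phi>)"
    then obtain x where x: "x \<in> X" "y = \<phi> g x"
      using X.surj_prop[OF assms(2)] by (auto simp: fixed_points_def)
    then have "\<phi> k x = x" if "k \<in> K" for k
      using y fix_iff[OF x(1) that] that by (auto simp: fixed_points_def conj_eq_image[OF assms(3,2)])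
    then show "y \<in> \<phi> g ` fixed_points K (X, \<phi>)" using x by (auto simp: fixed_points_def)
  next
    fix y assume "y \<in> \<phi> g ` fixed_points K (X, \<phi>)"
    then obtain x where x: "x \<in> X" "y = \<phi> g x" "\<And>k. k \<in> K \<Longrightarrow> \<phi> k x = x"
      by (auto simp: fixed_points_def)
    then show "y \<in> fixed_points (g <# K #> inv g) (X, \<phi>)"
      using fix_iff[OF x(1)] gset_closed[OF assms(1,2)]
      by (auto simp: fixed_points_def conj_eq_image[OF assms(3,2)])
  qed
  moreover have "inj_on (\<phi> g) (fixed_points K (X, \<phi>))"
    using X.inj_prop[OF assms(2)] by (rule inj_on_subset) (auto simp: fixed_points_def)
  ultimately show ?thesis by (simp add: card_image)
qed

lemma fixed_points_coset_nonempty: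
  assumes H: "subgroup H G" and K: "K \<subseteq> carrier G" and ne: "fixed_points K (coset_gset G H) \<noteq> {}"
  obtains g where "g \<in> carrier G" "K \<subseteq> g <# H #> inv g"
proof -
  obtain C where C: "C \<in> lcosets H" "\<And>k. k \<in> K \<Longrightarrow> k <# C = C"
    using ne by (auto simp: fixed_points_def coset_gset_def)
  then obtain g where g: "g \<in> carrier G" "C = g <# H" by (auto simp: LCOSETS_def)
  have "K \<subseteq> stabilizer G (\<lambda>g. \<lambda>C \<in> lcosets H. g <# C) C"
    using K C by (auto simp: stabilizer_def)
  then show thesis using that[OF g(1)] coset_stabilizer[OF H g(1)] by (simp add: g(2))
qed

text \<open>The coset \<open>H\<close> is fixed by \<open>H\<close>. The nonzero value is the pivot
  by which \<open>realized_indicator\<close> divides.\<close>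

lemma coset_mark_self:
  assumes "H \<in> F"
  shows "card (fixed_points H (coset_gset G H)) \<noteq> 0"
proof -
  have H: "subgroup H G" using assms by (rule family_subgroup)
  have one: "\<one> <# H = H" using family_subset[OF assms] by (rule lcos_mult_one)
  then have mem: "H \<in> lcosets H" unfolding LCOSETS_def by force
  have "stabilizer G (\<lambda>g. \<lambda>C \<in> lcosets H. g <# C) H = H"
    using coset_stabilizer[OF H one_closed] conj_one[OF family_subset[OF assms]] by (simp only: one)
  then have "H \<in> fixed_points H (coset_gset G H)"
    using mem by (auto simp: fixed_points_def coset_gset_def stabilizer_def)
  moreover have "finite (fixed_points H (coset_gset G H))"
    by (simp add: fixed_points_def coset_gset_def LCOSETS_def finite_carrier)
  ultimately show ?thesis by auto
qed

text \<open>A fixed coset would put \<open>L\<close> inside a conjugate of \<open>H\<close>, which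
  has no more elements than \<open>L\<close>, so the two would coincide.\<close>

lemma coset_mark_not_conj:
  assumes "H \<in> F" "L \<in> F" "card H \<le> card L" "L \<notin> conj_class G H"
  shows "card (fixed_points L (coset_gset G H)) = 0"
proof (rule ccontr)
  assume "card (fixed_points L (coset_gset G H)) \<noteq> 0"
  then have "fixed_points L (coset_gset G H) \<noteq> {}" by auto
  then obtain g where g: "g \<in> carrier G" "L \<subseteq> g <# H #> inv g"
    by (rule fixed_points_coset_nonempty[OF family_subgroup[OF assms(1)] family_subset[OF assms(2)]])
  have "finite (g <# H #> inv g)"
    using conj_closed_carrier[OF family_subset[OF assms(1)] g(1)] finite_carrier by (rule finite_subset)
  then have "L = g <# H #> inv g"
    using g(2) assms(3) card_conj[OF family_subset[OF assms(1)] g(1)] by (intro card_seteq) auto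
  then show False using g(1) assms(4) by (auto simp: conj_class_def)
qed

lemma card_conj_class_member:
  assumes "H \<in> F" "K \<in> conj_class G H"
  shows "card K = card H"
  using assms card_conj[OF family_subset] by (auto simp: conj_class_def)

lemma mark_conj_class:
  assumes "isotropy_in G F' S" "K \<subseteq> carrier G" "L \<in> conj_class G K"
  shows "card (fixed_points L S) = card (fixed_points K S)"
  using assms card_fixed_points_conj
  by (cases S) (auto simp: conj_class_def isotropy_in_def is_finite_gset_def)

text \<open>The table of marks is triangular for the order of subgroups: among subgroups of order at
  least \<open>card H\<close>, the marks of the coset space of \<open>H\<close> live on the class of
  \<open>H\<close> alone. Its values at smaller subgroups are subtracted by means of the induction
  hypothesis.\<close>

lemma realized_indicator:
  assumes "H \<in> F"
  shows "realized (\<lambda>L. if L \<in> conj_class G H then 1 else 0)"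
  using assms
proof (induction "card H" arbitrary: H rule: less_induct)
  case less
  define m where "m L = (of_nat (card (fixed_points L (coset_gset G H))) :: rat)" for L
  define A where "A = {K \<in> F. card K < card H}"
  have m0: "m H \<noteq> 0" using coset_mark_self[OF less.prems] by (simp add: m_def)
  have mconj: "m L = m K" if "K \<in> F" "L \<in> conj_class G K" for K L
    using mark_conj_class[OF isotropy_in_coset[OF less.prems] family_subset[OF that(1)] that(2)]
    by (simp add: m_def)
  \<comment> \<open>This is to equal \<open>m\<close> at subgroups of smaller order than
    \<open>H\<close> and zero at the others. The sum runs over subgroups instead of conjugacy
    classes, so each class contributes once per member and the coefficient is divided by its
    size.\<close>
  define w where "w L = (\<Sum>K\<in>A. m K / of_nat (card (conj_class G K)) *
      (if L \<in> conj_class G K then 1 else 0))" for L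
  have "finite A" using finite_family by (simp add: A_def)
  then have w: "realized w"
    unfolding w_def by (intro realized_sum realized_scale less.hyps) (auto simp: A_def)
  have "realized (\<lambda>L. 1 / m H * (m L + (-1) * w L))"
    using realized_coset[OF less.prems] w by (intro realized_scale realized_add) (simp_all add: m_def)
  then show ?case
  proof (rule realized_cong)
    fix L assume L: "L \<in> F"
    have Lc: "L \<subseteq> carrier G" using L by (rule family_subset)
    have iff: "L \<in> conj_class G K \<longleftrightarrow> K \<in> conj_class G L" if "K \<in> F" for K
      using conj_class_sym[OF Lc] conj_class_sym[OF family_subset[OF that]] by blast
    show "1 / m H * (m L + (-1) * w L) = (if L \<in> conj_class G H then 1 else 0)"
    proof (cases "card L < card H")
      case True
      \<comment> \<open>Exactly the conjugates of \<open>L\<close> contribute to \<open>w L\<close>;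
        they all lie in \<open>A\<close>, and their equal coefficients add up to
        \<open>m L\<close>.\<close>
      have sub: "conj_class G L \<subseteq> A"
        using conj_class_subset[OF L] card_conj_class_member[OF L] True by (auto simp: A_def)
      have "w L = (\<Sum>K\<in>conj_class G L. m K / of_nat (card (conj_class G K)))"
        unfolding w_def
      proof (rule sum.mono_neutral_cong_right[OF \<open>finite A\<close> sub])
        show "\<forall>K\<in>A - conj_class G L. m K / of_nat (card (conj_class G K)) *
            (if L \<in> conj_class G K then 1 else 0) = 0"
          using iff by (auto simp: A_def)
        show "m K / of_nat (card (conj_class G K)) * (if L \<in> conj_class G K then 1 else 0) =
            m K / of_nat (card (conj_class G K))" if "K \<in> conj_class G L" for K
          using conj_class_sym[OF Lc that] by simp
      qed
      also have "\<dots> = (\<Sum>K\<in>conj_class G L. m L / of_nat (card (conj_class G L)))"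
        by (rule sum.cong) (simp_all add: mconj[OF L] conj_class_eq[OF Lc])
      also have "\<dots> = m L"
      proof -
        have "finite (conj_class G L)" "conj_class G L \<noteq> {}"
          using conj_class_self[OF Lc] finite_carrier by (auto simp: conj_class_def)
        then show ?thesis by simp
      qed
      finally have "w L = m L" .
      moreover have "L \<notin> conj_class G H" using card_conj_class_member[OF less.prems] True by auto
      ultimately show ?thesis by simp
    next
      case False
      \<comment> \<open>Conjugate subgroups have equal order, so \<open>L\<close> is conjugate to no
        member of \<open>A\<close>.\<close>
      have "w L = 0"
        unfolding w_def using False card_conj_class_member by (intro sum.neutral) (fastforce simp: A_def)
      moreover have "m L = 0" if "L \<notin> conj_class G H"
        using coset_mark_not_conj[OF less.prems L] False that by (simp add: m_def)
      ultimately show ?thesis using m0 mconj[OF less.prems] by auto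
    qed
  qed
qed

text \<open>Existence of a preimage comes from \<open>realized_indicator\<close> and uniqueness from
  separation by marks, so \<open>the_inv_into\<close> selects an actual preimage of the
  characteristic function.\<close>

lemma idempotent_marks:
  assumes "H \<in> F"
  defines "e \<equiv> the_inv_into (carrier (rational_gset_ring G (isotropy_gsets G F))) (marks F)
    (char_fun F (conj_class G H))"
  shows "e \<in> carrier (rational_gset_ring G (isotropy_gsets G F))"
    and "K \<in> F \<Longrightarrow> rat_extend (groth_extend (mark K)) e = (if K \<in> conj_class G H then 1 else 0)"
proof -
  let ?B = "rational_gset_ring G (isotropy_gsets G F)"
  obtain x where x: "x \<in> carrier ?B"
    "\<And>K. K \<in> F \<Longrightarrow> rat_extend (groth_extend (mark K)) x = (if K \<in> conj_class G H then 1 else 0)"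
    using realized_indicator[OF assms(1)] by (auto simp: realized_def)
  \<comment> \<open>Both functions are restricted to \<open>F\<close>, hence agree outside it as
    well.\<close>
  then have "char_fun F (conj_class G H) = marks F x"
    by (auto simp: char_fun_def marks_eq)
  moreover have "inj_on (marks F) (carrier ?B)"
  proof (rule inj_onI)
    fix x y assume xy: "x \<in> carrier ?B" "y \<in> carrier ?B" "marks F x = marks F y"
    show "x = y"
    proof (rule B.mark_inj[OF xy(1,2)])
      fix K assume "K \<in> F"
      then show "rat_extend (groth_extend (mark K)) x = rat_extend (groth_extend (mark K)) y"
        using fun_cong[OF xy(3), of K] by (simp add: marks_eq)
    qed
  qed
  ultimately have "e = x" unfolding e_def using x(1) by (simp add: the_inv_into_f_f)
  then show "e \<in> carrier ?B"
    and "K \<in> F \<Longrightarrow> rat_extend (groth_extend (mark K)) e = (if K \<in> conj_class G H then 1 else 0)"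
    using x by simp_all
qed

end

section \<open>Admissible hulls\<close>

context transfer_system
begin

text \<open>Reflexivity of the order applies to the whole group. Every subset thus has an admissible
  overgroup, so hulls have something to choose from.\<close>

lemma carrier_admissible: "carrier G \<in> admissible_subgroups G \<O>"
proof -
  have "carrier G \<in> subgroups G" by (simp add: subgroups_def subgroup_self)
  moreover from this have "(carrier G, carrier G) \<in> \<O>"
    using partial_order by (auto simp: partial_order_on_def preorder_on_def refl_on_def)
  ultimately show ?thesis by (simp add: admissible_subgroups_def)
qed

lemma admissible_subgroup: "H \<in> admissible_subgroups G \<O> \<Longrightarrow> subgroup H G"
  by (simp add: admissible_subgroups_def subgroups_def)

lemma conj_carrier:
  assumes "g \<in> carrier G"
  shows "g <# carrier G #> inv g = carrier G"
  using mem_conj_iff[OF subset_refl assms] conj_closed_carrier[OF subset_refl assms] assms by auto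

lemma conj_admissible:
  assumes "H \<in> admissible_subgroups G \<O>" "g \<in> carrier G"
  shows "g <# H #> inv g \<in> admissible_subgroups G \<O>"
  using assms conj_subgroup[OF admissible_subgroup[OF assms(1)] assms(2)]
    conj_closed[of H "carrier G" g] conj_carrier[OF assms(2)]
  by (simp add: admissible_subgroups_def subgroups_def)

text \<open>Restricting the arrow from \<open>H\<close> to the whole group along \<open>K\<close>
  gives an arrow from \<open>H \<inter> K\<close> to \<open>K\<close>, which composes with the one
  from \<open>K\<close> to the whole group.\<close>

lemma Int_admissible:
  assumes "H \<in> admissible_subgroups G \<O>" "K \<in> admissible_subgroups G \<O>"
  shows "H \<inter> K \<in> admissible_subgroups G \<O>"
proof -
  have sub: "subgroup H G" "subgroup K G" using assms admissible_subgroup by blast+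
  have "(H \<inter> K, K) \<in> \<O>"
    using assms(1) restriction_closed[OF _ sub(2) subgroup.subset[OF sub(2)], of H]
    by (simp add: admissible_subgroups_def)
  moreover have "(K, carrier G) \<in> \<O>" using assms(2) by (simp add: admissible_subgroups_def)
  ultimately have "(H \<inter> K, carrier G) \<in> \<O>"
    using partial_order unfolding partial_order_on_def preorder_on_def by (blast dest: transD)
  then show ?thesis
    using subgroups_Inter_pair[OF sub] by (simp add: admissible_subgroups_def subgroups_def)
qed

end

section \<open>Hulls in a transfer system of a finite group\<close>

locale finite_transfer_system = transfer_system +
  assumes finite_carrier: "finite (carrier G)"
begin

text \<open>By finiteness there is a minimal admissible subgroup containing \<open>J\<close>;
  closure under intersection makes it least, so the \<open>LEAST\<close> in
  \<open>admissible_hull\<close> is attained.\<close>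

lemma hull_least:
  assumes "J \<subseteq> carrier G"
  shows "admissible_hull G \<O> J \<in> admissible_subgroups G \<O>"
    and "J \<subseteq> admissible_hull G \<O> J"
    and "\<lbrakk>H \<in> admissible_subgroups G \<O>; J \<subseteq> H\<rbrakk> \<Longrightarrow> admissible_hull G \<O> J \<subseteq> H"
proof -
  let ?P = "\<lambda>H. H \<in> admissible_subgroups G \<O> \<and> J \<subseteq> H"
  let ?A = "{H. ?P H}"
  have "finite ?A"
    by (rule finite_subset[of _ "Pow (carrier G)"])
      (use admissible_subgroup subgroup.subset finite_carrier in blast)+
  moreover have "?A \<noteq> {}" using carrier_admissible assms by blast
  ultimately have "\<exists>m\<in>?A. \<forall>H\<in>?A. H \<subseteq> m \<longrightarrow> m = H"
    by (rule finite_has_minimal)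
  then obtain m where m: "m \<in> ?A" and min: "\<forall>H\<in>?A. H \<subseteq> m \<longrightarrow> m = H"
    by (rule bexE)
  have least: "m \<subseteq> H" if "?P H" for H
  proof -
    have "m \<inter> H \<in> ?A" using m that Int_admissible by blast
    then have "m = m \<inter> H" using min by blast
    then show ?thesis by blast
  qed
  have "admissible_hull G \<O> J = m"
    unfolding admissible_hull_def using m least by (intro Least_equality) auto
  then show "admissible_hull G \<O> J \<in> admissible_subgroups G \<O>" "J \<subseteq> admissible_hull G \<O> J"
    "\<lbrakk>H \<in> admissible_subgroups G \<O>; J \<subseteq> H\<rbrakk> \<Longrightarrow> admissible_hull G \<O> J \<subseteq> H"
    using m least by auto
qed

lemma hull_subset_iff:
  assumes "J \<subseteq> carrier G" "H \<in> admissible_subgroups G \<O>"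
  shows "admissible_hull G \<O> J \<subseteq> H \<longleftrightarrow> J \<subseteq> H"
  using hull_least[OF assms(1)] assms(2) by blast

lemma hull_admissible: "H \<in> admissible_subgroups G \<O> \<Longrightarrow> admissible_hull G \<O> H = H"
  using hull_least[of H] subgroup.subset[OF admissible_subgroup] by blast

text \<open>The conjugated hull is admissible and contains the conjugate of \<open>J\<close>, which
  gives one inclusion for every group element. Its instance for \<open>inv g\<close>, conjugated
  back by \<open>g\<close>, is the other inclusion.\<close>

lemma hull_conj:
  assumes J: "J \<subseteq> carrier G" and g: "g \<in> carrier G"
  shows "admissible_hull G \<O> (g <# J #> inv g) = g <# admissible_hull G \<O> J #> inv g"
proof (rule equalityI)
  have sub: "admissible_hull G \<O> (h <# L #> inv h) \<subseteq> h <# admissible_hull G \<O> L #> inv h"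
    if "L \<subseteq> carrier G" "h \<in> carrier G" for L h
    using that hull_least(1,2)[OF that(1)]
    by (intro hull_least(3) conj_closed_carrier conj_admissible conj_mono)
  show "admissible_hull G \<O> (g <# J #> inv g) \<subseteq> g <# admissible_hull G \<O> J #> inv g"
    using J g by (rule sub)
  have gJ: "g <# J #> inv g \<subseteq> carrier G" using J g by (rule conj_closed_carrier)
  have "admissible_hull G \<O> J \<subseteq> inv g <# admissible_hull G \<O> (g <# J #> inv g) #> inv (inv g)"
    using sub[OF gJ inv_closed[OF g]] by (simp only: conj_inv_cancel(1)[OF J g])
  from conj_mono[OF this, of g]
  show "g <# admissible_hull G \<O> J #> inv g \<subseteq> admissible_hull G \<O> (g <# J #> inv g)"
    using conj_inv_cancel(2)[OF subgroup.subset[OF admissible_subgroup[OF hull_least(1)[OF gJ]]] g]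
    by (simp only:)
qed

sublocale all: subgroup_family G "subgroups G"
  by unfold_locales (simp_all add: finite_carrier subgroups_def conj_subgroup)

sublocale adm: subgroup_family G "admissible_subgroups G \<O>"
proof
  show "admissible_subgroups G \<O> \<subseteq> subgroups G" by (auto simp: admissible_subgroups_def)
qed (simp_all add: finite_carrier conj_admissible)

lemma admissible_gsets_eq:
  "admissible_gsets G \<O> = isotropy_gsets G (admissible_subgroups G \<O>)"
  unfolding admissible_gsets_def adm.isotropy_gsets_eq_orbit_condition ..

text \<open>Being fixed by a subset means that the stabilizer contains it; for admissible
  stabilizers this is the universal property \<open>hull_subset_iff\<close>.\<close>

lemma fixed_points_hull:
  assumes "isotropy_in G (admissible_subgroups G \<O>) T" "K \<subseteq> carrier G"
  shows "fixed_points (admissible_hull G \<O> K) T = fixed_points K T"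
proof -
  obtain X \<phi> where T: "T = (X, \<phi>)" by (cases T)
  have hull: "admissible_hull G \<O> K \<subseteq> carrier G"
    using hull_least(1)[OF assms(2)] by (rule adm.family_subset)
  have fixed: "(\<forall>k\<in>L. \<phi> k x = x) \<longleftrightarrow> L \<subseteq> stabilizer G \<phi> x" if "L \<subseteq> carrier G" for L x
    using that by (auto simp: stabilizer_def)
  show ?thesis
    using assms(1) hull_subset_iff[OF assms(2)]
    by (auto simp: T fixed_points_def fixed[OF hull] fixed[OF assms(2)] isotropy_in_def)
qed

section \<open>Inseparability classes\<close>

lemma insep_class_eq:
  assumes "H \<in> admissible_subgroups G \<O>"
  shows "insep_class G \<O> H = {K \<in> subgroups G. admissible_hull G \<O> K \<in> conj_class G H}"
  by (simp add: insep_class_def inseparable_def hull_admissible[OF assms])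

text \<open>Hulls of conjugate subgroups are conjugate by \<open>hull_conj\<close>. An
  inseparability class is therefore a union of conjugacy classes, which gives the index set of the
  final sum its meaning.\<close>

lemma conj_class_subset_insep_class:
  assumes "H \<in> admissible_subgroups G \<O>" "K \<in> insep_class G \<O> H"
  shows "conj_class G K \<subseteq> insep_class G \<O> H"
proof
  have H: "H \<subseteq> carrier G" using assms(1) by (rule adm.family_subset)
  have K: "K \<in> subgroups G" "admissible_hull G \<O> K \<in> conj_class G H"
    using assms(2) by (simp_all add: insep_class_eq[OF assms(1)])
  fix L assume "L \<in> conj_class G K"
  then obtain g where g: "g \<in> carrier G" "L = g <# K #> inv g" by (auto simp: conj_class_def)
  have "admissible_hull G \<O> L \<in> conj_class G (admissible_hull G \<O> K)"
    unfolding g(2) hull_conj[OF all.family_subset[OF K(1)] g(1)]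
    using g(1) by (auto simp: conj_class_def)
  then show "L \<in> insep_class G \<O> H"
    using K all.family_conj[OF K(1) g(1)] conj_class_eq[OF H K(2)]
    by (simp add: insep_class_eq[OF assms(1)] g(2))
qed

text \<open>On isomorphism classes the inclusion is the identity, so compatibility with the hull is
  the equality of fixed points in \<open>fixed_points_hull\<close>.\<close>

lemma semiring_inclusion:
  "marked_hom (gset_semiring G (admissible_gsets G \<O>)) mark (admissible_subgroups G \<O>)
    (gset_semiring G (finite_gsets G)) mark (subgroups G) (\<lambda>a. a) (admissible_hull G \<O>)"
  unfolding admissible_gsets_eq finite_gsets_eq
proof (intro marked_hom.intro marked_hom_axioms.intro adm.S.marked_monoid_axioms
    all.S.marked_monoid_axioms)
  fix a assume a: "a \<in> carrier (gset_semiring G (isotropy_gsets G (admissible_subgroups G \<O>)))"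
  then obtain T :: "('a, nat) gset" where T: "isotropy_in G (admissible_subgroups G \<O>) T" "a = iso_class G T"
    by (rule semiring_carrierE)
  then have T': "isotropy_in G (subgroups G) T"
    by (auto simp: isotropy_in_def admissible_subgroups_def split: prod.splits)
  show "a \<in> carrier (gset_semiring G (isotropy_gsets G (subgroups G)))"
    unfolding T(2) using T' by (rule iso_class_in_semiring)
  show "mark K a = mark (admissible_hull G \<O> K) a" if K: "K \<in> subgroups G" for K
  proof -
    have Kc: "K \<subseteq> carrier G" using K by (rule all.family_subset)
    show ?thesis
      unfolding T(2) mark_iso_class[OF T(1) Kc]
        mark_iso_class[OF T(1) adm.family_subset[OF hull_least(1)[OF Kc]]]
        fixed_points_hull[OF T(1) Kc] ..
  qed
next
  show "admissible_hull G \<O> K \<in> admissible_subgroups G \<O>" if "K \<in> subgroups G" for K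
    using hull_least(1)[OF all.family_subset[OF that]] .
qed

text \<open>The inclusion is built in the two layers \<open>groth_map\<close> and
  \<open>rat_map\<close>, and the general lifting lemmas carry the mark formula through
  each.\<close>

lemma burnside_inclusion_hom:
  "marked_hom (transfer_burnside_ring G \<O>) (\<lambda>K. rat_extend (groth_extend (mark K)))
    (admissible_subgroups G \<O>) (burnside_ring G) (\<lambda>K. rat_extend (groth_extend (mark K)))
    (subgroups G) (burnside_inclusion G) (admissible_hull G \<O>)"
  unfolding rational_gset_ring_def burnside_inclusion_def
proof (intro marked_group_hom.rat_hom marked_group_hom.intro marked_hom.groth_hom semiring_inclusion)
  show "abelian_group (groth_ring (gset_semiring G (admissible_gsets G \<O>)))"
    unfolding admissible_gsets_eq by (rule adm.S.groth_abelian_group)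
  show "abelian_group (groth_ring (gset_semiring G (finite_gsets G)))"
    unfolding finite_gsets_eq by (rule all.S.groth_abelian_group)
qed

theorem burnside_inclusion_idempotent:
  assumes H: "H \<in> admissible_subgroups G \<O>"
  shows "burnside_inclusion G (transfer_idempotent G \<O> (conj_class G H)) =
    (\<Oplus>\<^bsub>burnside_ring G\<^esub> C \<in> conj_class G ` insep_class G \<O> H. burnside_idempotent G C)"
proof -
  interpret incl: marked_hom "transfer_burnside_ring G \<O>" "\<lambda>K. rat_extend (groth_extend (mark K))"
    "admissible_subgroups G \<O>" "burnside_ring G" "\<lambda>K. rat_extend (groth_extend (mark K))"
    "subgroups G" "burnside_inclusion G" "admissible_hull G \<O>"
    by (rule burnside_inclusion_hom)
  let ?e = "transfer_idempotent G \<O> (conj_class G H)"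
  let ?\<nu> = "\<lambda>K. rat_extend (groth_extend (mark K))"
  let ?I = "insep_class G \<O> H"
  have e: "?e \<in> carrier (transfer_burnside_ring G \<O>)"
    "\<And>K. K \<in> admissible_subgroups G \<O> \<Longrightarrow> ?\<nu> K ?e = (if K \<in> conj_class G H then 1 else 0)"
    using adm.idempotent_marks[OF H] unfolding transfer_idempotent_def admissible_gsets_eq by blast+
  have ec: "burnside_idempotent G (conj_class G K) \<in> carrier (burnside_ring G)"
    "\<And>L. L \<in> subgroups G \<Longrightarrow>
      ?\<nu> L (burnside_idempotent G (conj_class G K)) = (if L \<in> conj_class G K then 1 else 0)"
    if "K \<in> subgroups G" for K
    using all.idempotent_marks[OF that] unfolding burnside_idempotent_def finite_gsets_eq by blast+
  have I: "?I \<subseteq> subgroups G" by (auto simp: insep_class_def)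
  have closed: "burnside_idempotent G \<in> conj_class G ` ?I \<rightarrow> carrier (burnside_ring G)"
    using ec(1) I by blast
  show ?thesis
  proof (rule incl.S.mark_inj)
    show "burnside_inclusion G ?e \<in> carrier (burnside_ring G)" using e(1) by (rule incl.hom_closed)
    show "(\<Oplus>\<^bsub>burnside_ring G\<^esub> C \<in> conj_class G ` ?I. burnside_idempotent G C) \<in> carrier (burnside_ring G)"
      using closed by (rule incl.S.finsum_closed)
    fix L assume L: "L \<in> subgroups G"
    have Lc: "L \<subseteq> carrier G" using L by (rule all.family_subset)
    have fin: "finite (conj_class G ` ?I)"
      using finite_subset[OF I all.finite_family] by (rule finite_imageI)
    \<comment> \<open>Conjugacy classes are disjoint, so only the idempotent of the class of
      \<open>L\<close> can have a nonzero mark at \<open>L\<close>.\<close>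
    have mem: "C = conj_class G L" if C: "C \<in> conj_class G ` ?I" and "L \<in> C" for C
    proof -
      obtain K where K: "K \<in> ?I" "C = conj_class G K" using C by blast
      have "K \<subseteq> carrier G" using K(1) I all.family_subset by blast
      then show ?thesis using conj_class_eq[of K L] \<open>L \<in> C\<close> K(2) by simp
    qed
    have "?\<nu> L (\<Oplus>\<^bsub>burnside_ring G\<^esub> C \<in> conj_class G ` ?I. burnside_idempotent G C) =
        (\<Sum>C\<in>conj_class G ` ?I. ?\<nu> L (burnside_idempotent G C))"
      using L closed by (rule incl.S.mark_finsum)
    also have "\<dots> = (\<Sum>C\<in>conj_class G ` ?I. if C = conj_class G L then 1 else 0)"
    proof (rule sum.cong[OF refl])
      fix C assume C: "C \<in> conj_class G ` ?I"
      have mem_iff: "L \<in> C \<longleftrightarrow> C = conj_class G L"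
        using mem[OF C] conj_class_self[OF Lc] by metis
      from C have "?\<nu> L (burnside_idempotent G C) = (if L \<in> C then 1 else 0)"
        using ec(2)[OF _ L] I by auto
      then show "?\<nu> L (burnside_idempotent G C) = (if C = conj_class G L then 1 else 0)"
        unfolding mem_iff .
    qed
    also have "\<dots> = (if conj_class G L \<in> conj_class G ` ?I then 1 else 0)"
      using fin by (simp add: sum.delta')
    \<comment> \<open>Distinct representatives may name the same conjugacy class; as
      \<open>?I\<close> is closed under conjugation, the test can be made on \<open>L\<close>
      itself.\<close>
    also have "conj_class G L \<in> conj_class G ` ?I \<longleftrightarrow> L \<in> ?I"
    proof
      assume "conj_class G L \<in> conj_class G ` ?I"
      then obtain K where "K \<in> ?I" "conj_class G L = conj_class G K" by blast
      then show "L \<in> ?I"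
        using conj_class_subset_insep_class[OF H, of K] conj_class_self[OF Lc] by blast
    qed blast
    \<comment> \<open>Inseparability of \<open>L\<close> from \<open>H\<close> says that the hull of
      \<open>L\<close> is conjugate to \<open>H\<close>, which is what the mark of the transfer
      idempotent at this hull detects.\<close>
    also have "(if L \<in> ?I then 1 else 0) = ?\<nu> (admissible_hull G \<O> L) ?e"
      using e(2)[OF incl.index_closed[OF L]] L by (simp add: insep_class_eq[OF H])
    also have "\<dots> = ?\<nu> L (burnside_inclusion G ?e)"
      using incl.mark_hom[OF L e(1)] by simp
    finally show "?\<nu> L (burnside_inclusion G ?e) =
        ?\<nu> L (\<Oplus>\<^bsub>burnside_ring G\<^esub> C \<in> conj_class G ` ?I. burnside_idempotent G C)" ..
  qed
qed

end

theorem corollary3p28: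
  fixes G :: "('g, 'm) monoid_scheme" and \<O> :: "('g set \<times> 'g set) set" and H :: "'g set"
  assumes "transfer_system G \<O>"
    and "finite (carrier G)"
    and "H \<in> admissible_subgroups G \<O>"
  shows "burnside_inclusion G (transfer_idempotent G \<O> (conj_class G H)) =
    (\<Oplus>\<^bsub>burnside_ring G\<^esub> C \<in> conj_class G ` insep_class G \<O> H. burnside_idempotent G C)"
proof -
  interpret finite_transfer_system G \<O>
    using assms(1,2) by (simp add: finite_transfer_system_def finite_transfer_system_axioms_def)
  show ?thesis using assms(3) by (rule burnside_inclusion_idempotent)
qed

end
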